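(* Let $(F,\eta)$ be a pointed endofunctor of $\mathcal{C}$ and let $\mathcal{S}$ be a co-perfect syntopogenous structure on $\mathcal{C}$ with respect to $\mathcal{M}$. For $X\in\mathcal{C}$ put $$\mathcal{B}^{\mathcal{S}^{F,\eta}}_X=\{U^{\sqsubset^{F,\eta}}\;|\;U^{\sqsubset}\in\mathcal{B}^{\mathcal{S}}_{FX}\},\qquad U^{\sqsubset^{F,\eta}}(m)=\eta_X^{-1}\big(U^{\sqsubset}(\eta_X(m))\big)\quad(m\in\mathrm{sub}X).$$ Then $\mathcal{B}^{\mathcal{S}^{F,\eta}}$ is a base for the coarsest quasi-uniformity $\mathcal{U}^{\mathcal{S}^{F,\eta}}$ on $\mathcal{C}$ with respect to $\mathcal{M}$ for which every $\eta_X:X\to FX$ is $(\mathcal{U}^{\mathcal{S}^{F,\eta}},\mathcal{U}^{\mathcal{S}})$-continuous. Moreover, $\mathcal{B}^{\mathcal{S}^{F,\eta}}$ is a transitive base provided that $\mathcal{S}$ is interpolative.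
   Context: $\mathcal{C}$ is a category with a proper $(\mathcal{E},\mathcal{M})$-factorization system for morphisms ($\mathcal{E}$ consists of epimorphisms, $\mathcal{M}$ of monomorphisms), and it is $\mathcal{M}$-complete: pullbacks of $\mathcal{M}$-morphisms along arbitrary morphisms and arbitrary $\mathcal{M}$-intersections exist and are again in $\mathcal{M}$. The class $\mathcal{E}$ is stable under pullbacks along $\mathcal{M}$-morphisms. For $X\in\mathcal{C}$, $\mathrm{sub}X=\{m\in\mathcal{M}\mid \mathrm{cod}(m)=X\}$, ordered by $n\le m$ iff $m\circ j=n$ for some $j$; isomorphic subobjects are identified, so $\mathrm{sub}X$ is a (possibly large) complete lattice. For $f:X\to Y$, $f(m)$ is the $\mathcal{M}$-component of the factorization of $f\circ m$ and $f^{-1}(n)$ is the pullback of $n$ along $f$. A pointed endofunctor $(F,\eta)$ is a functor $F:\mathcal{C}\to\mathcal{C}$ with a natural transformation $\eta:1_{\mathcal{C}}\to F$. A topogenous order on $\mathcal{C}$ is a family of relations $\sqsubset_X$ on $\mathrm{sub}X$ ($X\in\mathcal{C}$) with (T1) $m\sqsubset_X n\Rightarrow m\le n$; (T2) $m\le n\sqsubset_X p\le q\Rightarrow m\sqsubset_X q$; (T3) for every $f:X\to Y$, $m\sqsubset_Y n\Rightarrow f^{-1}(m)\sqsubset_X f^{-1}(n)$. A relation is $\bigwedge$-preserving if ($m\sqsubset_X n_i$ for all $i\in I$) implies $m\sqsubset_X\bigwedge n_i$, and interpolates if $m\sqsubset_X n$ implies $m\sqsubset_X p\sqsubset_X n$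 for some $p$. A syntopogenous structure on $\mathcal{C}$ is a family $\mathcal{S}=\{\mathcal{S}_X\}$ of sets of relations on $\mathrm{sub}X$ such that (S1) each $\sqsubset_X\in\mathcal{S}_X$ satisfies (T1), (T2); (S2) $\mathcal{S}_X$ is directed under inclusion; (S3) the relations $\bigcup\mathcal{S}_X$ form an interpolative topogenous order. It is co-perfect (interpolative) if every $\sqsubset_X\in\mathcal{S}_X$ is $\bigwedge$-preserving (interpolates). A quasi-uniformity on $\mathcal{C}$ with respect to $\mathcal{M}$ is a family $\mathcal{U}=\{\mathcal{U}_X\mid X\in\mathcal{C}\}$, each $\mathcal{U}_X$ a collection of order-preserving maps $\mathrm{sub}X\to\mathrm{sub}X$ (ordered pointwise), such that (U1) $1_X\le U$ (i.e. $m\le U(m)$ for all $m$) for $U\in\mathcal{U}_X$; (U2) for $U\in\mathcal{U}_X$ there is $U'\in\mathcal{U}_X$ with $U'\circ U'\le U$; (U3) $U\in\mathcal{U}_X$, $U\le U'$ imply $U'\in\mathcal{U}_X$; (U4) $U,U'\in\mathcal{U}_X$ imply $U\wedge U'\in\mathcal{U}_X$; (U5) for $f:X\to Y$ and $U\in\mathcal{U}_Y$ there is $U'\in\mathcal{U}_X$ with $f(U'(m))\le U(f(m))$ for all $m\in\mathrm{sub}X$. A base is a family $\mathcal{B}=\{\mathcal{B}_X\}$ satisfying all of these except (U3); the quasi-uniformity it generates consists of all $V$ lying above some member of the base. A base is transitive if $U\circ U=U$ for all its members. Order: $\mathcal{U}\le\mathcal{V}$ iff for all $X$ and $U\in\mathcal{U}_X$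 there is $V\in\mathcal{V}_X$ with $V\le U$; "coarsest" means least. A morphism $f:X\to Y$ is $(\mathcal{U},\mathcal{U}')$-continuous if for any $U'\in\mathcal{U}'_Y$ there is $U\in\mathcal{U}_X$ with $f(U(m))\le U'(f(m))$ for all $m\in\mathrm{sub}X$. For co-perfect $\mathcal{S}$: $\mathcal{B}^{\mathcal{S}}_X=\{U^{\sqsubset}\mid\sqsubset_X\in\mathcal{S}_X\}$ with $U^{\sqsubset}(m)=\bigwedge\{n\mid m\sqsubset_X n\}$. Co-perfect syntopogenous structures are understood to be those corresponding to quasi-uniformities: $\mathcal{B}^{\mathcal{S}}$ is a base for a quasi-uniformity, denoted $\mathcal{U}^{\mathcal{S}}$. $\mathcal{U}^{\mathcal{S}^{F,\eta}}$ denotes the quasi-uniformity generated by $\mathcal{B}^{\mathcal{S}^{F,\eta}}$. *)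

theory Defs
  imports "HOL-Algebra.Complete_Lattice"
begin

text \<open>
  A category together with two distinguished classes of morphisms, \<open>EE\<close> and \<open>MM\<close>.
  Objects and morphisms form arbitrary sets \<open>Ob\<close>, \<open>Ar\<close> over types;
  these play the role of the (possibly proper) classes of the informal theory.
  \<open>g \<cdot> f\<close> is ``first \<open>f\<close>, then \<open>g\<close>''.
\<close>

record ('o, 'a) fact_cat =
  Ob :: "'o set"
  Ar :: "'a set"
  Dom :: "'a \<Rightarrow> 'o"
  Cod :: "'a \<Rightarrow> 'o"
  Ide :: "'o \<Rightarrow> 'a"
  Comp :: "'a \<Rightarrow> 'a \<Rightarrow> 'a" (infixr "\<cdot>\<index>" 75)
  EE :: "'a set"
  MM :: "'a set"

definition Hom :: "('o, 'a, 'b) fact_cat_scheme \<Rightarrow> 'o \<Rightarrow> 'o \<Rightarrow> 'a set" where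
  "Hom C X Y = {f \<in> Ar C. Dom C f = X \<and> Cod C f = Y}"

locale category =
  fixes C :: "('o, 'a, 'b) fact_cat_scheme" (structure)
  assumes Dom_Ob: "f \<in> Ar C \<Longrightarrow> Dom C f \<in> Ob C"
    and Cod_Ob: "f \<in> Ar C \<Longrightarrow> Cod C f \<in> Ob C"
    and Ide_Hom: "X \<in> Ob C \<Longrightarrow> Ide C X \<in> Hom C X X"
    and Comp_Hom: "\<lbrakk>f \<in> Hom C X Y; g \<in> Hom C Y Z\<rbrakk> \<Longrightarrow> g \<cdot> f \<in> Hom C X Z"
    and Comp_Ide: "f \<in> Hom C X Y \<Longrightarrow> f \<cdot> Ide C X = f"
    and Ide_Comp: "f \<in> Hom C X Y \<Longrightarrow> Ide C Y \<cdot> f = f"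
    and Comp_assoc: "\<lbrakk>f \<in> Hom C W X; g \<in> Hom C X Y; h \<in> Hom C Y Z\<rbrakk>
      \<Longrightarrow> (h \<cdot> g) \<cdot> f = h \<cdot> (g \<cdot> f)"

definition is_iso :: "('o, 'a, 'b) fact_cat_scheme \<Rightarrow> 'a \<Rightarrow> bool" where
  "is_iso C f \<longleftrightarrow> f \<in> Ar C \<and>
     (\<exists>g \<in> Hom C (Cod C f) (Dom C f).
        g \<cdot>\<^bsub>C\<^esub> f = Ide C (Dom C f) \<and> f \<cdot>\<^bsub>C\<^esub> g = Ide C (Cod C f))"

definition is_mono :: "('o, 'a, 'b) fact_cat_scheme \<Rightarrow> 'a \<Rightarrow> bool" where
  "is_mono C f \<longleftrightarrow> f \<in> Ar C \<and>
     (\<forall>X. \<forall>g \<in> Hom C X (Dom C f). \<forall>h \<in> Hom C X (Dom C f).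
        f \<cdot>\<^bsub>C\<^esub> g = f \<cdot>\<^bsub>C\<^esub> h \<longrightarrow> g = h)"

definition is_epi :: "('o, 'a, 'b) fact_cat_scheme \<Rightarrow> 'a \<Rightarrow> bool" where
  "is_epi C f \<longleftrightarrow> f \<in> Ar C \<and>
     (\<forall>X. \<forall>g \<in> Hom C (Cod C f) X. \<forall>h \<in> Hom C (Cod C f) X.
        g \<cdot>\<^bsub>C\<^esub> f = h \<cdot>\<^bsub>C\<^esub> f \<longrightarrow> g = h)"

text \<open>
  \<open>is_pullback C f n p q\<close>: the square \<open>f \<cdot> p = n \<cdot> q\<close> is a pullback,
  so \<open>p\<close> is the pullback of \<open>n\<close> along \<open>f\<close> and \<open>q\<close> is the pullback of \<open>f\<close> along \<open>n\<close>.
\<close>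

definition is_pullback :: "('o, 'a, 'b) fact_cat_scheme \<Rightarrow> 'a \<Rightarrow> 'a \<Rightarrow> 'a \<Rightarrow> 'a \<Rightarrow> bool" where
  "is_pullback C f n p q \<longleftrightarrow>
     f \<in> Ar C \<and> n \<in> Ar C \<and> Cod C f = Cod C n \<and>
     p \<in> Hom C (Dom C p) (Dom C f) \<and> q \<in> Hom C (Dom C p) (Dom C n) \<and>
     f \<cdot>\<^bsub>C\<^esub> p = n \<cdot>\<^bsub>C\<^esub> q \<and>
     (\<forall>Z. \<forall>u \<in> Hom C Z (Dom C f). \<forall>v \<in> Hom C Z (Dom C n).
        f \<cdot>\<^bsub>C\<^esub> u = n \<cdot>\<^bsub>C\<^esub> v \<longrightarrow>
        (\<exists>!k. k \<in> Hom C Z (Dom C p) \<and> p \<cdot>\<^bsub>C\<^esub> k = u \<and> q \<cdot>\<^bsub>C\<^esub> k = v))"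

definition factors_through :: "('o, 'a, 'b) fact_cat_scheme \<Rightarrow> 'a \<Rightarrow> 'a \<Rightarrow> bool" where
  "factors_through C f n \<longleftrightarrow> (\<exists>j \<in> Hom C (Dom C f) (Dom C n). n \<cdot>\<^bsub>C\<^esub> j = f)"

text \<open>
  The intersection (multiple pullback) of a family \<open>A\<close> of monomorphisms with codomain \<open>X\<close>.
  As the members of \<open>A\<close> are monic, a cone over \<open>A\<close> is the same as a morphism into \<open>X\<close>
  factoring through each of them. For \<open>A = {}\<close> one obtains the isomorphisms onto \<open>X\<close>.
\<close>

definition is_intersection :: "('o, 'a, 'b) fact_cat_scheme \<Rightarrow> 'o \<Rightarrow> 'a set \<Rightarrow> 'a \<Rightarrow> bool" where
  "is_intersection C X A p \<longleftrightarrow>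
     p \<in> Hom C (Dom C p) X \<and> (\<forall>n \<in> A. factors_through C p n) \<and>
     (\<forall>Z. \<forall>u \<in> Hom C Z X. (\<forall>n \<in> A. factors_through C u n) \<longrightarrow>
        (\<exists>!k. k \<in> Hom C Z (Dom C p) \<and> p \<cdot>\<^bsub>C\<^esub> k = u))"

locale factorization_system = category +
  assumes EE_Ar: "EE C \<subseteq> Ar C"
    and MM_Ar: "MM C \<subseteq> Ar C"
    and EE_iso: "\<lbrakk>e \<in> EE C; is_iso C i; Dom C i = Cod C e\<rbrakk> \<Longrightarrow> i \<cdot> e \<in> EE C"
    and MM_iso: "\<lbrakk>m \<in> MM C; is_iso C i; Cod C i = Dom C m\<rbrakk> \<Longrightarrow> m \<cdot> i \<in> MM C"
    and factorization:
      "f \<in> Ar C \<Longrightarrow> \<exists>e \<in> EE C. \<exists>m \<in> MM C. Cod C e = Dom C m \<and> f = m \<cdot> e"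
    and diagonal: "\<lbrakk>e \<in> EE C; m \<in> MM C; u \<in> Hom C (Dom C e) (Dom C m);
        v \<in> Hom C (Cod C e) (Cod C m); v \<cdot> e = m \<cdot> u\<rbrakk>
      \<Longrightarrow> \<exists>!d. d \<in> Hom C (Cod C e) (Dom C m) \<and> d \<cdot> e = u \<and> m \<cdot> d = v"

locale proper_factorization_system = factorization_system +
  assumes EE_epi: "e \<in> EE C \<Longrightarrow> is_epi C e"
    and MM_mono: "m \<in> MM C \<Longrightarrow> is_mono C m"

locale M_complete_category = proper_factorization_system +
  assumes pullback_exists:
      "\<lbrakk>f \<in> Ar C; n \<in> MM C; Cod C n = Cod C f\<rbrakk> \<Longrightarrow> \<exists>p q. is_pullback C f n p q"
    and pullback_MM: "\<lbrakk>n \<in> MM C; is_pullback C f n p q\<rbrakk> \<Longrightarrow> p \<in> MM C"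
    and intersection_exists:
      "\<lbrakk>X \<in> Ob C; A \<subseteq> {m \<in> MM C. Cod C m = X}\<rbrakk> \<Longrightarrow> \<exists>p. is_intersection C X A p"
    and intersection_MM:
      "\<lbrakk>X \<in> Ob C; A \<subseteq> {m \<in> MM C. Cod C m = X}; is_intersection C X A p\<rbrakk> \<Longrightarrow> p \<in> MM C"

locale EE_stable_category = M_complete_category +
  assumes EE_stable: "\<lbrakk>e \<in> EE C; n \<in> MM C; is_pullback C n e p q\<rbrakk> \<Longrightarrow> p \<in> EE C"

text \<open>
  Subobjects: isomorphism classes of \<open>MM\<close>-morphisms into \<open>X\<close>, so that the order below is
  a genuine partial order (with underlying equality).
\<close>

definition sub_iso :: "('o, 'a, 'b) fact_cat_scheme \<Rightarrow> 'o \<Rightarrow> ('a \<times> 'a) set" where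
  "sub_iso C X = {(m, n). m \<in> MM C \<and> n \<in> MM C \<and> Cod C m = X \<and> Cod C n = X \<and>
     (\<exists>j. is_iso C j \<and> j \<in> Hom C (Dom C n) (Dom C m) \<and> m \<cdot>\<^bsub>C\<^esub> j = n)}"

definition Sub :: "('o, 'a, 'b) fact_cat_scheme \<Rightarrow> 'o \<Rightarrow> 'a set gorder" where
  "Sub C X = \<lparr>carrier = {m \<in> MM C. Cod C m = X} // sub_iso C X,
     eq = (=),
     le = (\<lambda>a b. \<exists>n \<in> a. \<exists>m \<in> b. factors_through C n m)\<rparr>"

text \<open>
  Image and preimage of (classes of) subobjects, as the class of all \<open>MM\<close>-components of
  \<open>(EE, MM)\<close>-factorizations of \<open>f \<cdot> m\<close>, respectively of all pullbacks along \<open>f\<close>.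
\<close>

definition img :: "('o, 'a, 'b) fact_cat_scheme \<Rightarrow> 'a \<Rightarrow> 'a set \<Rightarrow> 'a set" where
  "img C f a = {n \<in> MM C. \<exists>m \<in> a. \<exists>e \<in> EE C. Cod C e = Dom C n \<and> f \<cdot>\<^bsub>C\<^esub> m = n \<cdot>\<^bsub>C\<^esub> e}"

definition preimg :: "('o, 'a, 'b) fact_cat_scheme \<Rightarrow> 'a \<Rightarrow> 'a set \<Rightarrow> 'a set" where
  "preimg C f b = {p. \<exists>n \<in> b. \<exists>q. is_pullback C f n p q}"

locale pointed_endofunctor = category +
  fixes Fo :: "'o \<Rightarrow> 'o" and Fa :: "'a \<Rightarrow> 'a" and \<eta> :: "'o \<Rightarrow> 'a"
  assumes F_Ob: "X \<in> Ob C \<Longrightarrow> Fo X \<in> Ob C"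
    and F_Hom: "f \<in> Hom C X Y \<Longrightarrow> Fa f \<in> Hom C (Fo X) (Fo Y)"
    and F_Ide: "X \<in> Ob C \<Longrightarrow> Fa (Ide C X) = Ide C (Fo X)"
    and F_Comp: "\<lbrakk>f \<in> Hom C X Y; g \<in> Hom C Y Z\<rbrakk> \<Longrightarrow> Fa (g \<cdot> f) = Fa g \<cdot> Fa f"
    and \<eta>_Hom: "X \<in> Ob C \<Longrightarrow> \<eta> X \<in> Hom C X (Fo X)"
    and \<eta>_natural: "f \<in> Hom C X Y \<Longrightarrow> Fa f \<cdot> \<eta> X = \<eta> Y \<cdot> f"

definition topogenous_rel ::
  "('o, 'a, 'b) fact_cat_scheme \<Rightarrow> 'o \<Rightarrow> 'a set rel \<Rightarrow> bool" where
  "topogenous_rel C X R \<longleftrightarrow>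
     R \<subseteq> carrier (Sub C X) \<times> carrier (Sub C X) \<and>
     (\<forall>m n. (m, n) \<in> R \<longrightarrow> m \<sqsubseteq>\<^bsub>Sub C X\<^esub> n) \<and>
     (\<forall>m \<in> carrier (Sub C X). \<forall>n p. \<forall>q \<in> carrier (Sub C X).
        m \<sqsubseteq>\<^bsub>Sub C X\<^esub> n \<and> (n, p) \<in> R \<and> p \<sqsubseteq>\<^bsub>Sub C X\<^esub> q \<longrightarrow> (m, q) \<in> R)"

definition topogenous_order ::
  "('o, 'a, 'b) fact_cat_scheme \<Rightarrow> ('o \<Rightarrow> 'a set rel) \<Rightarrow> bool" where
  "topogenous_order C R \<longleftrightarrow>
     (\<forall>X \<in> Ob C. topogenous_rel C X (R X)) \<and>
     (\<forall>X \<in> Ob C. \<forall>Y \<in> Ob C. \<forall>f \<in> Hom C X Y. \<forall>m n.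
        (m, n) \<in> R Y \<longrightarrow> (preimg C f m, preimg C f n) \<in> R X)"

definition interpolates :: "'a rel \<Rightarrow> bool" where
  "interpolates R \<longleftrightarrow> (\<forall>m n. (m, n) \<in> R \<longrightarrow> (\<exists>p. (m, p) \<in> R \<and> (p, n) \<in> R))"

text \<open>The empty family is included: every \<open>m\<close> is then related to the largest subobject.\<close>

definition meet_preserving ::
  "('o, 'a, 'b) fact_cat_scheme \<Rightarrow> 'o \<Rightarrow> 'a set rel \<Rightarrow> bool" where
  "meet_preserving C X R \<longleftrightarrow>
     (\<forall>m \<in> carrier (Sub C X). \<forall>A \<subseteq> carrier (Sub C X).
        (\<forall>n \<in> A. (m, n) \<in> R) \<longrightarrow> (m, \<Sqinter>\<^bsub>Sub C X\<^esub> A) \<in> R)"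

definition syntopogenous ::
  "('o, 'a, 'b) fact_cat_scheme \<Rightarrow> ('o \<Rightarrow> 'a set rel set) \<Rightarrow> bool" where
  "syntopogenous C S \<longleftrightarrow>
     (\<forall>X \<in> Ob C. \<forall>R \<in> S X. topogenous_rel C X R) \<and>
     (\<forall>X \<in> Ob C. S X \<noteq> {} \<and> (\<forall>R \<in> S X. \<forall>R' \<in> S X. \<exists>R'' \<in> S X. R \<subseteq> R'' \<and> R' \<subseteq> R'')) \<and>
     topogenous_order C (\<lambda>X. \<Union> (S X)) \<and>
     (\<forall>X \<in> Ob C. interpolates (\<Union> (S X)))"

definition co_perfect ::
  "('o, 'a, 'b) fact_cat_scheme \<Rightarrow> ('o \<Rightarrow> 'a set rel set) \<Rightarrow> bool" where
  "co_perfect C S \<longleftrightarrow> (\<forall>X \<in> Ob C. \<forall>R \<in> S X. meet_preserving C X R)"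

definition interpolative ::
  "('o, 'a, 'b) fact_cat_scheme \<Rightarrow> ('o \<Rightarrow> 'a set rel set) \<Rightarrow> bool" where
  "interpolative C S \<longleftrightarrow> (\<forall>X \<in> Ob C. \<forall>R \<in> S X. interpolates R)"

text \<open>
  Self-maps of \<open>Sub C X\<close> are taken to be extensional (undefined outside the carrier), so that
  sets of them behave as sets of functions on the carrier.
\<close>

definition endomaps :: "('o, 'a, 'b) fact_cat_scheme \<Rightarrow> 'o \<Rightarrow> ('a set \<Rightarrow> 'a set) set" where
  "endomaps C X = {U \<in> carrier (Sub C X) \<rightarrow>\<^sub>E carrier (Sub C X). Mono\<^bsub>Sub C X\<^esub> U}"

definition submap_le ::
  "('o, 'a, 'b) fact_cat_scheme \<Rightarrow> 'o \<Rightarrow> ('a set \<Rightarrow> 'a set) \<Rightarrow> ('a set \<Rightarrow> 'a set) \<Rightarrow> bool" where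
  "submap_le C X U V \<longleftrightarrow> (\<forall>m \<in> carrier (Sub C X). U m \<sqsubseteq>\<^bsub>Sub C X\<^esub> V m)"

definition submap_meet ::
  "('o, 'a, 'b) fact_cat_scheme \<Rightarrow> 'o \<Rightarrow> ('a set \<Rightarrow> 'a set) \<Rightarrow> ('a set \<Rightarrow> 'a set) \<Rightarrow> 'a set \<Rightarrow> 'a set"
  where "submap_meet C X U V = (\<lambda>m \<in> carrier (Sub C X). U m \<sqinter>\<^bsub>Sub C X\<^esub> V m)"

definition qu_base ::
  "('o, 'a, 'b) fact_cat_scheme \<Rightarrow> ('o \<Rightarrow> ('a set \<Rightarrow> 'a set) set) \<Rightarrow> bool" where
  \<comment> \<open>all axioms of a quasi-uniformity except upward closure; in particular closure under
    binary meets is literal, not just up to passing to a smaller member\<close>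
  "qu_base C \<B> \<longleftrightarrow>
     (\<forall>X \<in> Ob C. \<B> X \<subseteq> endomaps C X) \<and>
     (\<forall>X \<in> Ob C. \<forall>U \<in> \<B> X. \<forall>m \<in> carrier (Sub C X). m \<sqsubseteq>\<^bsub>Sub C X\<^esub> U m) \<and>
     (\<forall>X \<in> Ob C. \<forall>U \<in> \<B> X. \<exists>U' \<in> \<B> X. submap_le C X (compose (carrier (Sub C X)) U' U') U) \<and>
     (\<forall>X \<in> Ob C. \<forall>U \<in> \<B> X. \<forall>U' \<in> \<B> X. submap_meet C X U U' \<in> \<B> X) \<and>
     (\<forall>X \<in> Ob C. \<forall>Y \<in> Ob C. \<forall>f \<in> Hom C X Y. \<forall>U \<in> \<B> Y. \<exists>U' \<in> \<B> X.
        \<forall>m \<in> carrier (Sub C X). img C f (U' m) \<sqsubseteq>\<^bsub>Sub C Y\<^esub> U (img C f m))"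

definition quasi_uniformity ::
  "('o, 'a, 'b) fact_cat_scheme \<Rightarrow> ('o \<Rightarrow> ('a set \<Rightarrow> 'a set) set) \<Rightarrow> bool" where
  "quasi_uniformity C \<U> \<longleftrightarrow> qu_base C \<U> \<and>
     (\<forall>X \<in> Ob C. \<forall>U \<in> \<U> X. \<forall>U' \<in> endomaps C X. submap_le C X U U' \<longrightarrow> U' \<in> \<U> X)"

definition qu_generated ::
  "('o, 'a, 'b) fact_cat_scheme \<Rightarrow> ('o \<Rightarrow> ('a set \<Rightarrow> 'a set) set) \<Rightarrow> 'o \<Rightarrow> ('a set \<Rightarrow> 'a set) set"
  where "qu_generated C \<B> X = {V \<in> endomaps C X. \<exists>U \<in> \<B> X. submap_le C X U V}"

definition transitive_base ::
  "('o, 'a, 'b) fact_cat_scheme \<Rightarrow> ('o \<Rightarrow> ('a set \<Rightarrow> 'a set) set) \<Rightarrow> bool" where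
  "transitive_base C \<B> \<longleftrightarrow> qu_base C \<B> \<and>
     (\<forall>X \<in> Ob C. \<forall>U \<in> \<B> X. compose (carrier (Sub C X)) U U = U)"

text \<open>\<open>qu_coarser C \<U> \<V>\<close> is the order \<open>\<U> \<le> \<V>\<close>.\<close>

definition qu_coarser ::
  "('o, 'a, 'b) fact_cat_scheme \<Rightarrow> ('o \<Rightarrow> ('a set \<Rightarrow> 'a set) set) \<Rightarrow>
   ('o \<Rightarrow> ('a set \<Rightarrow> 'a set) set) \<Rightarrow> bool" where
  "qu_coarser C \<U> \<V> \<longleftrightarrow> (\<forall>X \<in> Ob C. \<forall>U \<in> \<U> X. \<exists>V \<in> \<V> X. submap_le C X V U)"

definition qu_continuous ::
  "('o, 'a, 'b) fact_cat_scheme \<Rightarrow> ('o \<Rightarrow> ('a set \<Rightarrow> 'a set) set) \<Rightarrow>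
   ('o \<Rightarrow> ('a set \<Rightarrow> 'a set) set) \<Rightarrow> 'a \<Rightarrow> bool" where
  "qu_continuous C \<U> \<U>' f \<longleftrightarrow>
     (\<forall>U' \<in> \<U>' (Cod C f). \<exists>U \<in> \<U> (Dom C f). \<forall>m \<in> carrier (Sub C (Dom C f)).
        img C f (U m) \<sqsubseteq>\<^bsub>Sub C (Cod C f)\<^esub> U' (img C f m))"

definition coarsest_qu ::
  "('o, 'a, 'b) fact_cat_scheme \<Rightarrow> (('o \<Rightarrow> ('a set \<Rightarrow> 'a set) set) \<Rightarrow> bool) \<Rightarrow>
   ('o \<Rightarrow> ('a set \<Rightarrow> 'a set) set) \<Rightarrow> bool" where
  "coarsest_qu C P \<U> \<longleftrightarrow> quasi_uniformity C \<U> \<and> P \<U> \<and>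
     (\<forall>\<V>. quasi_uniformity C \<V> \<and> P \<V> \<longrightarrow> qu_coarser C \<U> \<V>)"

definition rel_map ::
  "('o, 'a, 'b) fact_cat_scheme \<Rightarrow> 'o \<Rightarrow> 'a set rel \<Rightarrow> 'a set \<Rightarrow> 'a set" where
  "rel_map C X R = (\<lambda>m \<in> carrier (Sub C X). \<Sqinter>\<^bsub>Sub C X\<^esub> {n. (m, n) \<in> R})"

definition syn_base ::
  "('o, 'a, 'b) fact_cat_scheme \<Rightarrow> ('o \<Rightarrow> 'a set rel set) \<Rightarrow> 'o \<Rightarrow> ('a set \<Rightarrow> 'a set) set" where
  "syn_base C S X = rel_map C X ` S X"

definition pointed_syn_base ::
  "('o, 'a, 'b) fact_cat_scheme \<Rightarrow> ('o \<Rightarrow> 'o) \<Rightarrow> ('o \<Rightarrow> 'a) \<Rightarrow> ('o \<Rightarrow> 'a set rel set) \<Rightarrow>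
   'o \<Rightarrow> ('a set \<Rightarrow> 'a set) set" where
  "pointed_syn_base C Fo \<eta> S X =
     {\<lambda>m \<in> carrier (Sub C X). preimg C (\<eta> X) (U (img C (\<eta> X) m)) | U. U \<in> syn_base C S (Fo X)}"

end

theory Submission
  imports Defs
begin

text \<open>
  Image and preimage along \<open>f: X \<rightarrow> Y\<close> are adjoint, since both \<open>f(m) \<le> n\<close> and
  \<open>m \<le> f\<^sup>-\<^sup>1(n)\<close> say that \<open>f \<cdot> m\<close> factors through \<open>n\<close>; in particular images are
  functorial. Hence \<open>V(m) = f\<^sup>-\<^sup>1(U(f(m)))\<close> is the largest map with \<open>f(V(m)) \<le> U(f(m))\<close>,
  which makes the maps of this form for \<open>f = \<eta>\<^sub>X\<close> generate the coarsest candidate. They satisfy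
  (U5) because \<open>Ff \<cdot> \<eta>\<^sub>X = \<eta>\<^sub>Y \<cdot> f\<close> transports (U5) for \<open>Ff\<close> to \<open>f\<close>. If \<open>\<sqsubset>\<close> preserves meets
  and interpolates, then \<open>m \<sqsubset> n\<close> implies \<open>U(m) \<sqsubset> n\<close> for \<open>U = U\<^sup>\<sqsubset>\<close>, so \<open>U\<close> is idempotent,
  and this passes to \<open>V\<close> because \<open>f(f\<^sup>-\<^sup>1(n)) \<le> n\<close>.
\<close>

section \<open>Factoring one morphism through another, and pullbacks of monomorphisms\<close>

context category
begin

lemma Ar_HomI: "f \<in> Ar C \<Longrightarrow> f \<in> Hom C (Dom C f) (Cod C f)"
  by (simp add: Hom_def)

lemma HomD:
  assumes "f \<in> Hom C X Y"
  shows "f \<in> Ar C" "Dom C f = X" "Cod C f = Y" "X \<in> Ob C" "Y \<in> Ob C"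
  using assms Dom_Ob[of f] Cod_Ob[of f] by (auto simp: Hom_def)

lemma factors_through_refl:
  assumes "f \<in> Ar C"
  shows "factors_through C f f"
  using Comp_Ide[OF Ar_HomI[OF assms]] Ide_Hom[OF Dom_Ob[OF assms]]
  by (auto simp: factors_through_def)

lemma factors_through_trans:
  assumes "n \<in> Ar C" and fg: "factors_through C f g" and gn: "factors_through C g n"
  shows "factors_through C f n"
proof -
  obtain j where j: "j \<in> Hom C (Dom C f) (Dom C g)" "g \<cdot> j = f"
    using fg by (auto simp: factors_through_def)
  obtain k where k: "k \<in> Hom C (Dom C g) (Dom C n)" "n \<cdot> k = g"
    using gn by (auto simp: factors_through_def)
  have "n \<cdot> (k \<cdot> j) = f"
    using Comp_assoc[OF j(1) k(1) Ar_HomI[OF assms(1)]] j(2) k(2) by simp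
  with Comp_Hom[OF j(1) k(1)] show ?thesis
    by (auto simp: factors_through_def)
qed

lemma factors_through_Comp_left:
  assumes g: "g \<in> Hom C X Y" and n: "n \<in> Hom C W X" and f: "f \<in> Hom C Z X"
    and fn: "factors_through C f n"
  shows "factors_through C (g \<cdot> f) (g \<cdot> n)"
proof -
  obtain j where j: "j \<in> Hom C Z W" "n \<cdot> j = f"
    using fn n f by (auto simp: factors_through_def Hom_def)
  have "(g \<cdot> n) \<cdot> j = g \<cdot> f"
    using Comp_assoc[OF j(1) n g] j(2) by simp
  with j(1) HomD(2)[OF Comp_Hom[OF n g]] HomD(2)[OF Comp_Hom[OF f g]] show ?thesis
    by (auto simp: factors_through_def)
qed

lemma is_monoD:
  "\<lbrakk>is_mono C m; g \<in> Hom C X (Dom C m); h \<in> Hom C X (Dom C m); m \<cdot> g = m \<cdot> h\<rbrakk> \<Longrightarrow> g = h"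
  unfolding is_mono_def by blast

text \<open>This is the universal property with the component into \<open>Dom C n\<close> forgotten:
  a factorization \<open>v\<close> of \<open>f \<cdot> u\<close> through \<open>n\<close> completes
  \<open>u\<close> to a cone, and composing with \<open>q\<close> goes back. Preimages can thus be
  handled by \<open>factors_through\<close> alone.\<close>

lemma factors_through_pullback:
  assumes pb: "is_pullback C f n p q" and f: "f \<in> Hom C X Y" and u: "u \<in> Hom C Z X"
  shows "factors_through C u p \<longleftrightarrow> factors_through C (f \<cdot> u) n"
proof
  have n: "n \<in> Hom C (Dom C n) Y" and p: "p \<in> Hom C (Dom C p) X"
    and q: "q \<in> Hom C (Dom C p) (Dom C n)" and eq: "f \<cdot> p = n \<cdot> q"
    using pb f by (auto simp: is_pullback_def Hom_def)
  have Dfu: "Dom C (f \<cdot> u) = Z" using Comp_Hom[OF u f] by (rule HomD)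
  {
    assume "factors_through C u p"
    then obtain k where k: "k \<in> Hom C Z (Dom C p)" "p \<cdot> k = u"
      using u by (auto simp: factors_through_def Hom_def)
    have "f \<cdot> u = n \<cdot> (q \<cdot> k)"
      using Comp_assoc[OF k(1) p f] Comp_assoc[OF k(1) q n] eq k(2) by simp
    with Comp_Hom[OF k(1) q] Dfu show "factors_through C (f \<cdot> u) n"
      by (auto simp: factors_through_def)
  next
    assume "factors_through C (f \<cdot> u) n"
    then obtain v where v: "v \<in> Hom C Z (Dom C n)" "f \<cdot> u = n \<cdot> v"
      using Dfu unfolding factors_through_def by metis
    then obtain k where "k \<in> Hom C Z (Dom C p)" "p \<cdot> k = u"
      using pb u f unfolding is_pullback_def HomD(2)[OF f] by blast
    then show "factors_through C u p"
      using u by (auto simp: factors_through_def Hom_def)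
  }
qed

text \<open>For monomorphisms the factoring conditions are enough to recover a pullback: cancelling
  \<open>n\<close> gives the second equation \<open>q \<cdot> k = v\<close>, and cancelling
  \<open>p\<close> gives uniqueness of \<open>k\<close>.\<close>

lemma is_pullback_monoI:
  assumes f: "f \<in> Hom C X Y" and n: "n \<in> Hom C N Y" and p: "p \<in> Hom C P X"
    and "is_mono C n" "is_mono C p"
    and "factors_through C (f \<cdot> p) n"
    and univ: "\<And>Z u. \<lbrakk>u \<in> Hom C Z X; factors_through C (f \<cdot> u) n\<rbrakk> \<Longrightarrow> factors_through C u p"
  shows "\<exists>q. is_pullback C f n p q"
proof -
  note simps = HomD(2)[OF f] HomD(2)[OF n] HomD(2)[OF p] HomD(3)[OF f] HomD(3)[OF n]
  obtain q where q: "q \<in> Hom C P N" "n \<cdot> q = f \<cdot> p"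
    using assms(6) HomD(2)[OF Comp_Hom[OF p f]] simps by (auto simp: factors_through_def)
  have "\<exists>!k. k \<in> Hom C Z P \<and> p \<cdot> k = u \<and> q \<cdot> k = v"
    if u: "u \<in> Hom C Z X" and v: "v \<in> Hom C Z N" and eq: "f \<cdot> u = n \<cdot> v" for Z u v
  proof -
    have "factors_through C (f \<cdot> u) n"
      using HomD(2)[OF Comp_Hom[OF u f]] v eq simps by (auto simp: factors_through_def)
    then obtain k where k: "k \<in> Hom C Z P" "p \<cdot> k = u"
      using univ[OF u] HomD(2)[OF u] simps by (auto simp: factors_through_def)
    have "n \<cdot> (q \<cdot> k) = n \<cdot> v"
      using Comp_assoc[OF k(1) q(1) n] Comp_assoc[OF k(1) p f] q(2) k(2) eq by simp
    then have "q \<cdot> k = v"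
      using is_monoD[OF \<open>is_mono C n\<close>] Comp_Hom[OF k(1) q(1)] v simps by auto
    moreover have "k' = k" if "k' \<in> Hom C Z P" "p \<cdot> k' = u" for k'
      using is_monoD[OF \<open>is_mono C p\<close>] that k simps by auto
    ultimately show ?thesis using k by blast
  qed
  then have "is_pullback C f n p q"
    using f n p q HomD(1)[OF f] HomD(1)[OF n] unfolding is_pullback_def simps by simp
  then show ?thesis ..
qed

end

section \<open>Subobjects as classes of \<open>MM\<close>-morphisms, their order, and images\<close>

context proper_factorization_system
begin

lemma MM_Hom: "m \<in> MM C \<Longrightarrow> m \<in> Hom C (Dom C m) (Cod C m)"
  using MM_Ar Ar_HomI by blast

lemma EE_Hom: "e \<in> EE C \<Longrightarrow> e \<in> Hom C (Dom C e) (Cod C e)"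
  using EE_Ar Ar_HomI by blast

text \<open>Two monomorphisms that factor through each other do so by mutually inverse morphisms,
  since \<open>m \<cdot> (j \<cdot> i) = m\<close> cancels to an identity. So \<open>sub_iso\<close>
  is the symmetric part of the preorder \<open>factors_through\<close>.\<close>

lemma sub_iso_iff:
  "(m, n) \<in> sub_iso C X \<longleftrightarrow> m \<in> MM C \<and> n \<in> MM C \<and> Cod C m = X \<and> Cod C n = X \<and>
     factors_through C m n \<and> factors_through C n m"
proof (cases "m \<in> MM C \<and> n \<in> MM C \<and> Cod C m = X \<and> Cod C n = X")
  case True
  then have m: "m \<in> Hom C (Dom C m) X" and n: "n \<in> Hom C (Dom C n) X"
    and mono: "is_mono C m" "is_mono C n"
    using MM_Hom[of m] MM_Hom[of n] MM_mono by auto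
  have "(\<exists>j. is_iso C j \<and> j \<in> Hom C (Dom C n) (Dom C m) \<and> m \<cdot> j = n) \<longleftrightarrow>
      factors_through C m n \<and> factors_through C n m" (is "?L \<longleftrightarrow> ?R")
  proof
    assume ?L
    then obtain j i where j: "j \<in> Hom C (Dom C n) (Dom C m)" "m \<cdot> j = n"
      and i: "i \<in> Hom C (Dom C m) (Dom C n)" "j \<cdot> i = Ide C (Dom C m)"
      by (auto simp: is_iso_def Hom_def)
    have "n \<cdot> i = m"
      using Comp_assoc[OF i(1) j(1) m] i(2) j(2) Comp_Ide[OF m] by simp
    with i j show ?R by (auto simp: factors_through_def)
  next
    assume ?R
    then obtain j i where j: "j \<in> Hom C (Dom C n) (Dom C m)" "m \<cdot> j = n"
      and i: "i \<in> Hom C (Dom C m) (Dom C n)" "n \<cdot> i = m"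
      by (auto simp: factors_through_def)
    have "j \<cdot> i = Ide C (Dom C m)"
      using is_monoD[OF mono(1) Comp_Hom[OF i(1) j(1)] Ide_Hom] HomD(4)[OF m]
        Comp_assoc[OF i(1) j(1) m] j(2) i(2) Comp_Ide[OF m] by simp
    moreover have "i \<cdot> j = Ide C (Dom C n)"
      using is_monoD[OF mono(2) Comp_Hom[OF j(1) i(1)] Ide_Hom] HomD(4)[OF n]
        Comp_assoc[OF j(1) i(1) n] j(2) i(2) Comp_Ide[OF n] by simp
    ultimately have "is_iso C j"
      using i(1) j(1) by (auto simp: is_iso_def Hom_def)
    with j show ?L by blast
  qed
  with True show ?thesis by (simp add: sub_iso_def)
qed (auto simp: sub_iso_def)

lemma factors_through_MM_trans:
  "\<lbrakk>n \<in> MM C; factors_through C f g; factors_through C g n\<rbrakk> \<Longrightarrow> factors_through C f n"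
  using factors_through_trans MM_Ar by blast

lemma equiv_sub_iso: "equiv {m \<in> MM C. Cod C m = X} (sub_iso C X)"
proof (rule equivI)
  show "sub_iso C X \<subseteq> {m \<in> MM C. Cod C m = X} \<times> {m \<in> MM C. Cod C m = X}"
    by (auto simp: sub_iso_iff)
  show "refl_on {m \<in> MM C. Cod C m = X} (sub_iso C X)"
    using factors_through_refl MM_Ar by (auto simp: refl_on_def sub_iso_iff)
  show "sym (sub_iso C X)"
    by (auto simp: sym_def sub_iso_iff)
  show "trans (sub_iso C X)"
    using factors_through_MM_trans by (auto simp: trans_def sub_iso_iff)
qed

lemma sub_iso_commute: "(m, n) \<in> sub_iso C X \<longleftrightarrow> (n, m) \<in> sub_iso C X"
  by (auto simp: sub_iso_iff)

lemma Sub_nonempty: "a \<in> carrier (Sub C X) \<Longrightarrow> \<exists>m. m \<in> a"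
  using in_quotient_imp_non_empty[OF equiv_sub_iso] by (fastforce simp: Sub_def)

lemma Sub_mem:
  assumes "a \<in> carrier (Sub C X)" "m \<in> a"
  shows "m \<in> MM C" "Cod C m = X" "m \<in> Hom C (Dom C m) X"
  using in_quotient_imp_subset[OF equiv_sub_iso, of a X] assms MM_Hom[of m]
  by (auto simp: Sub_def)

lemma Sub_mem_iso:
  assumes "a \<in> carrier (Sub C X)" "m \<in> a"
  shows "n \<in> a \<longleftrightarrow> (m, n) \<in> sub_iso C X"
  using quotient_eq_iff[OF equiv_sub_iso, of a X a m n] assms
    in_quotient_imp_closed[OF equiv_sub_iso, of a X m n] by (auto simp: Sub_def)

lemma Sub_class:
  assumes "m \<in> MM C" "Cod C m = X"
  shows "sub_iso C X `` {m} \<in> carrier (Sub C X)" "m \<in> sub_iso C X `` {m}"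
  using assms factors_through_refl MM_Ar by (auto simp: Sub_def sub_iso_iff intro: quotientI)

text \<open>The order asks for some pair of representatives; as isomorphic representatives factor
  through each other, any chosen pair decides.\<close>

lemma Sub_le_iff:
  assumes a: "a \<in> carrier (Sub C X)" "m \<in> a" and b: "b \<in> carrier (Sub C X)" "n \<in> b"
  shows "a \<sqsubseteq>\<^bsub>Sub C X\<^esub> b \<longleftrightarrow> factors_through C m n"
proof
  assume "a \<sqsubseteq>\<^bsub>Sub C X\<^esub> b"
  then obtain m' n' where "m' \<in> a" "n' \<in> b" and *: "factors_through C m' n'"
    by (auto simp: Sub_def)
  then have "factors_through C m m'" "factors_through C n' n" "n \<in> MM C" "n' \<in> MM C"
    using Sub_mem_iso[OF a, of m'] Sub_mem_iso[OF b, of n'] by (simp_all add: sub_iso_iff)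
  with * show "factors_through C m n"
    using factors_through_MM_trans by blast
qed (use a b in \<open>auto simp: Sub_def\<close>)

lemma Sub_partial_order: "partial_order (Sub C X)"
proof
  fix a b c assume a: "a \<in> carrier (Sub C X)"
  show "a \<sqsubseteq>\<^bsub>Sub C X\<^esub> a"
    using Sub_nonempty[OF a] Sub_mem[OF a] Sub_le_iff[OF a _ a] factors_through_refl MM_Ar
    by blast
  assume b: "b \<in> carrier (Sub C X)"
  show "a .=\<^bsub>Sub C X\<^esub> b" if le: "a \<sqsubseteq>\<^bsub>Sub C X\<^esub> b" "b \<sqsubseteq>\<^bsub>Sub C X\<^esub> a"
  proof -
    obtain m n where mn: "m \<in> a" "n \<in> b" using Sub_nonempty[OF a] Sub_nonempty[OF b] by blast
    then have "(m, n) \<in> sub_iso C X"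
      using le Sub_le_iff[OF a _ b] Sub_le_iff[OF b _ a] Sub_mem[OF a] Sub_mem[OF b]
      by (simp add: sub_iso_iff)
    then have "a = b"
      using quotient_eq_iff[OF equiv_sub_iso] a b mn by (fastforce simp: Sub_def)
    then show ?thesis by (simp add: Sub_def)
  qed
  assume c: "c \<in> carrier (Sub C X)"
  show "a \<sqsubseteq>\<^bsub>Sub C X\<^esub> c" if "a \<sqsubseteq>\<^bsub>Sub C X\<^esub> b" "b \<sqsubseteq>\<^bsub>Sub C X\<^esub> c"
  proof -
    obtain k m n where "k \<in> a" "m \<in> b" "n \<in> c"
      using Sub_nonempty[OF a] Sub_nonempty[OF b] Sub_nonempty[OF c] by blast
    then show ?thesis
      using that Sub_le_iff[OF a _ b] Sub_le_iff[OF b _ c] Sub_le_iff[OF a _ c] Sub_mem[OF c]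
        factors_through_MM_trans by blast
  qed
qed (auto simp: Sub_def)

text \<open>The diagonal property makes \<open>n\<close> least among the \<open>MM\<close>-morphisms
  through which \<open>f \<cdot> m\<close> factors. Hence the \<open>MM\<close>-components of all
  such factorizations, for all representatives of \<open>a\<close>, lie in one class, and
  isomorphisms can be absorbed into the \<open>EE\<close>-component to fill that class.\<close>

lemma img_eq_class:
  assumes f: "f \<in> Hom C X Y" and a: "a \<in> carrier (Sub C X)" and m: "m \<in> a"
    and n: "n \<in> MM C" and e: "e \<in> EE C" "Cod C e = Dom C n" and eq: "f \<cdot> m = n \<cdot> e"
  shows "img C f a = sub_iso C Y `` {n}"
    and "Cod C n = Y"
    and "\<And>k. k \<in> MM C \<Longrightarrow> Cod C k = Y \<Longrightarrow> factors_through C n k \<longleftrightarrow> factors_through C (f \<cdot> m) k"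
proof -
  \<comment> \<open>Stated for an arbitrary representative and factorization because it serves
    twice: for the given \<open>n\<close> and for any other element of
    \<open>img C f a\<close>.\<close>
  have aux: "Cod C n' = Y \<and> (\<forall>k \<in> MM C. Cod C k = Y \<longrightarrow>
        (factors_through C n' k \<longleftrightarrow> factors_through C (f \<cdot> m') k))"
    if m': "m' \<in> a" and n': "n' \<in> MM C" and e': "e' \<in> EE C" "Cod C e' = Dom C n'"
      and eq': "f \<cdot> m' = n' \<cdot> e'" for m' n' e'
  proof -
    have hm: "m' \<in> Hom C (Dom C m') X" by (rule Sub_mem[OF a m'])
    have he: "e' \<in> Hom C (Dom C e') (Dom C n')" using EE_Hom e' by fastforce
    have hn: "n' \<in> Hom C (Dom C n') (Cod C n')" by (rule MM_Hom[OF n'])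
    have D: "Dom C m' = Dom C e'" and Cn: "Cod C n' = Y"
      using HomD[OF Comp_Hom[OF he hn]] HomD[OF Comp_Hom[OF hm f]] eq' by auto
    have "factors_through C n' k \<longleftrightarrow> factors_through C (f \<cdot> m') k"
      if k: "k \<in> MM C" "Cod C k = Y" for k
    proof
      assume "factors_through C n' k"
      moreover have "factors_through C (f \<cdot> m') n'"
        using he eq' HomD(2)[OF Comp_Hom[OF he hn]] by (auto simp: factors_through_def)
      ultimately show "factors_through C (f \<cdot> m') k"
        using factors_through_MM_trans k by blast
    next
      assume "factors_through C (f \<cdot> m') k"
      then obtain u where u: "u \<in> Hom C (Dom C e') (Dom C k)" "k \<cdot> u = n' \<cdot> e'"
        using eq' HomD(2)[OF Comp_Hom[OF he hn]] by (auto simp: factors_through_def)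
      \<comment> \<open>Diagonal of the square \<open>n' \<cdot> e' = k \<cdot> u\<close>; its
        triangle over \<open>k\<close> is the wanted factorization.\<close>
      then obtain d where "d \<in> Hom C (Dom C n') (Dom C k)" "k \<cdot> d = n'"
        using diagonal[OF e'(1) k(1), of u n'] hn Cn e'(2) k(2) by auto
      then show "factors_through C n' k" by (auto simp: factors_through_def)
    qed
    with Cn show ?thesis by blast
  qed
  note n_facts = aux[OF m n e eq]
  show "Cod C n = Y" using n_facts by blast
  show fac: "factors_through C n k \<longleftrightarrow> factors_through C (f \<cdot> m) k"
    if "k \<in> MM C" "Cod C k = Y" for k
    using n_facts that by blast
  show "img C f a = sub_iso C Y `` {n}"
  proof (intro equalityI subsetI)
    fix n' assume "n' \<in> img C f a"
    then obtain m' e' where n': "n' \<in> MM C" and m': "m' \<in> a" and e': "e' \<in> EE C"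
      "Cod C e' = Dom C n'" "f \<cdot> m' = n' \<cdot> e'"
      by (auto simp: img_def)
    note n'_facts = aux[OF m' n' e']
    have fr: "factors_through C n n" "factors_through C n' n'"
      using factors_through_refl MM_Ar n n' by auto
    have hm: "m \<in> Hom C (Dom C m) X" "m' \<in> Hom C (Dom C m') X"
      using Sub_mem[OF a] m m' by auto
    have "factors_through C m m'" "factors_through C m' m"
      using Sub_mem_iso[OF a m] m' by (auto simp: sub_iso_iff)
    then have mm': "factors_through C (f \<cdot> m) (f \<cdot> m')" "factors_through C (f \<cdot> m') (f \<cdot> m)"
      using factors_through_Comp_left[OF f] hm by blast+
    have "factors_through C (f \<cdot> m) n" "factors_through C (f \<cdot> m') n'"
      using n_facts n'_facts fr n n' by auto
    then have "factors_through C (f \<cdot> m') n" "factors_through C (f \<cdot> m) n'"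
      using mm' factors_through_MM_trans n n' by blast+
    then show "n' \<in> sub_iso C Y `` {n}"
      using n_facts n'_facts n n' by (auto simp: sub_iso_iff)
  next
    fix n' assume "n' \<in> sub_iso C Y `` {n}"
    \<comment> \<open>The pair is reversed so that \<open>j\<close> starts at
      \<open>Dom C n\<close>, where \<open>e\<close> ends, and \<open>j \<cdot> e\<close> is the new
      \<open>EE\<close>-component.\<close>
    then obtain j where n': "n' \<in> MM C" "Cod C n' = Y" and j: "is_iso C j"
      "j \<in> Hom C (Dom C n) (Dom C n')" "n' \<cdot> j = n"
      unfolding Image_singleton_iff sub_iso_commute[of n n'] by (auto simp: sub_iso_def)
    have he: "e \<in> Hom C (Dom C e) (Dom C n)" using EE_Hom e by fastforce
    have "j \<cdot> e \<in> EE C" using EE_iso[OF e(1) j(1)] HomD(2)[OF j(2)] e(2) by simp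
    moreover have "Cod C (j \<cdot> e) = Dom C n'" using Comp_Hom[OF he j(2)] by (rule HomD)
    moreover have "f \<cdot> m = n' \<cdot> (j \<cdot> e)"
      using Comp_assoc[OF he j(2) MM_Hom[OF n'(1)]] j(3) eq by simp
    ultimately show "n' \<in> img C f a"
      using n' m by (auto simp: img_def)
  qed
qed

text \<open>The least factorization from \<open>img_eq_class\<close>, read in the order of
  subobjects; this is the image half of the adjunction.\<close>

lemma
  assumes f: "f \<in> Hom C X Y" and a: "a \<in> carrier (Sub C X)"
  shows img_closed: "img C f a \<in> carrier (Sub C Y)"
    and img_le_iff: "\<lbrakk>m \<in> a; b \<in> carrier (Sub C Y); k \<in> b\<rbrakk> \<Longrightarrow>
      img C f a \<sqsubseteq>\<^bsub>Sub C Y\<^esub> b \<longleftrightarrow> factors_through C (f \<cdot> m) k"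
proof -
  have *: "img C f a \<in> carrier (Sub C Y) \<and> (\<forall>b \<in> carrier (Sub C Y). \<forall>k \<in> b.
      img C f a \<sqsubseteq>\<^bsub>Sub C Y\<^esub> b \<longleftrightarrow> factors_through C (f \<cdot> m) k)" if m: "m \<in> a" for m
  proof -
    have "f \<cdot> m \<in> Ar C"
      using Comp_Hom[OF Sub_mem(3)[OF a m] f] by (rule HomD)
    then obtain e n where en: "e \<in> EE C" "n \<in> MM C" "Cod C e = Dom C n" "f \<cdot> m = n \<cdot> e"
      using factorization by blast
    note img = img_eq_class[OF f a m en(2,1,3,4)]
    note cls = Sub_class[OF en(2) img(2), folded img(1)]
    show ?thesis
      using cls Sub_le_iff[OF cls] img(3) Sub_mem by blast
  qed
  show "img C f a \<in> carrier (Sub C Y)"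
    using * Sub_nonempty[OF a] by blast
  show "\<lbrakk>m \<in> a; b \<in> carrier (Sub C Y); k \<in> b\<rbrakk> \<Longrightarrow>
      img C f a \<sqsubseteq>\<^bsub>Sub C Y\<^esub> b \<longleftrightarrow> factors_through C (f \<cdot> m) k"
    using * by blast
qed

end

section \<open>Preimages, the adjunction with images, and the complete lattice of subobjects\<close>

context M_complete_category
begin

text \<open>Pullbacks of isomorphic representatives admit factorizations of the same morphisms, so
  they are isomorphic by \<open>factors_through_pullback\<close>. Conversely
  \<open>is_pullback_monoI\<close> exhibits every morphism isomorphic to \<open>p\<close> as a
  pullback of the same \<open>n\<close>.\<close>

lemma preimg_eq_class:
  assumes f: "f \<in> Hom C X Y" and b: "b \<in> carrier (Sub C Y)" and n: "n \<in> b"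
    and pb: "is_pullback C f n p q"
  shows "preimg C f b = sub_iso C X `` {p}" and "p \<in> MM C" and "Cod C p = X"
proof -
  have pM: "p' \<in> MM C \<and> Cod C p' = X" if "n' \<in> b" "is_pullback C f n' p' q'" for n' p' q'
    using pullback_MM[OF _ that(2)] Sub_mem(1)[OF b that(1)] that(2) f
    by (simp add: is_pullback_def Hom_def)
  show p: "p \<in> MM C" "Cod C p = X" using pM[OF n pb] by auto
  show "preimg C f b = sub_iso C X `` {p}"
  proof (intro equalityI subsetI)
    fix p' assume "p' \<in> preimg C f b"
    then obtain n' q' where n': "n' \<in> b" and pb': "is_pullback C f n' p' q'"
      by (auto simp: preimg_def)
    have p': "p' \<in> MM C" "Cod C p' = X" using pM[OF n' pb'] by auto
    have "factors_through C n n'" "factors_through C n' n"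
      using Sub_mem_iso[OF b n] n' by (auto simp: sub_iso_iff)
    moreover have h: "p \<in> Hom C (Dom C p) X" "p' \<in> Hom C (Dom C p') X"
      using p p' MM_Hom[of p] MM_Hom[of p'] by auto
    ultimately have "factors_through C p p'" "factors_through C p' p"
      using factors_through_pullback[OF pb f] factors_through_pullback[OF pb' f]
        factors_through_MM_trans Sub_mem(1)[OF b] n n' factors_through_refl HomD(1) by meson+
    then show "p' \<in> sub_iso C X `` {p}" using p p' by (auto simp: sub_iso_iff)
  next
    fix p' assume "p' \<in> sub_iso C X `` {p}"
    then have p': "p' \<in> MM C" "Cod C p' = X" "factors_through C p p'" "factors_through C p' p"
      by (auto simp: sub_iso_iff)
    have h: "p' \<in> Hom C (Dom C p') X" using p' MM_Hom[of p'] by auto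
    have "\<exists>q'. is_pullback C f n p' q'"
    proof (rule is_pullback_monoI[OF f Sub_mem(3)[OF b n] h])
      show "is_mono C n" "is_mono C p'"
        using MM_mono Sub_mem[OF b n] p' by auto
      show "factors_through C (f \<cdot> p') n"
        using factors_through_pullback[OF pb f h] p' by simp
      show "factors_through C u p'"
        if "u \<in> Hom C Z X" "factors_through C (f \<cdot> u) n" for Z u
        using factors_through_pullback[OF pb f that(1)] that(2) p' factors_through_MM_trans
        by blast
    qed
    then show "p' \<in> preimg C f b" using n by (auto simp: preimg_def)
  qed
qed

lemma
  assumes f: "f \<in> Hom C X Y" and b: "b \<in> carrier (Sub C Y)"
  shows preimg_closed: "preimg C f b \<in> carrier (Sub C X)"
    and factors_through_preimg_iff: "\<lbrakk>u \<in> Hom C Z X; p \<in> preimg C f b; n \<in> b\<rbrakk> \<Longrightarrow>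
      factors_through C u p \<longleftrightarrow> factors_through C (f \<cdot> u) n"
proof -
  obtain n where n: "n \<in> b" using Sub_nonempty[OF b] by blast
  then obtain p q where pb: "is_pullback C f n p q"
    using pullback_exists[of f n] Sub_mem[OF b n] HomD[OF f] by auto
  show "preimg C f b \<in> carrier (Sub C X)"
    using Sub_class(1) preimg_eq_class[OF f b n pb] by simp
next
  assume u: "u \<in> Hom C Z X" and p: "p \<in> preimg C f b" and n: "n \<in> b"
  from p obtain n' q' where n': "n' \<in> b" and pb': "is_pullback C f n' p q'"
    by (auto simp: preimg_def)
  have "factors_through C n n'" "factors_through C n' n"
    using Sub_mem_iso[OF b n] n' by (auto simp: sub_iso_iff)
  then have "factors_through C (f \<cdot> u) n' \<longleftrightarrow> factors_through C (f \<cdot> u) n"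
    using factors_through_MM_trans Sub_mem(1)[OF b] n n' by blast
  with factors_through_pullback[OF pb' f u]
  show "factors_through C u p \<longleftrightarrow> factors_through C (f \<cdot> u) n" by simp
qed

text \<open>For representatives \<open>m\<close> of \<open>a\<close> and \<open>n\<close> of
  \<open>b\<close>, both sides say that \<open>f \<cdot> m\<close> factors through
  \<open>n\<close>.\<close>

lemma img_preimg_adj:
  assumes f: "f \<in> Hom C X Y" and a: "a \<in> carrier (Sub C X)" and b: "b \<in> carrier (Sub C Y)"
  shows "img C f a \<sqsubseteq>\<^bsub>Sub C Y\<^esub> b \<longleftrightarrow> a \<sqsubseteq>\<^bsub>Sub C X\<^esub> preimg C f b"
proof -
  have pc: "preimg C f b \<in> carrier (Sub C X)" by (rule preimg_closed[OF f b])
  obtain m n p where "m \<in> a" "n \<in> b" "p \<in> preimg C f b"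
    using Sub_nonempty[OF a] Sub_nonempty[OF b] Sub_nonempty[OF pc] by blast
  then show ?thesis
    using img_le_iff[OF f a _ b] Sub_le_iff[OF a _ pc]
      factors_through_preimg_iff[OF f b Sub_mem(3)[OF a]] by blast
qed

text \<open>Both subobjects have the same upper bounds: by the adjunction along \<open>g\<close>,
  either one is below \<open>c\<close> iff \<open>g \<cdot> (f \<cdot> m)\<close> factors through
  \<open>c\<close>. No composition of \<open>EE\<close>-morphisms has to be considered.\<close>

lemma img_Comp:
  assumes f: "f \<in> Hom C X Y" and g: "g \<in> Hom C Y Z" and a: "a \<in> carrier (Sub C X)"
  shows "img C (g \<cdot> f) a = img C g (img C f a)"
proof -
  interpret Z: partial_order "Sub C Z" by (rule Sub_partial_order)
  have gf: "g \<cdot> f \<in> Hom C X Z" using f g by (rule Comp_Hom)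
  have fa: "img C f a \<in> carrier (Sub C Y)" using f a by (rule img_closed)
  have *: "img C (g \<cdot> f) a \<sqsubseteq>\<^bsub>Sub C Z\<^esub> c \<longleftrightarrow> img C g (img C f a) \<sqsubseteq>\<^bsub>Sub C Z\<^esub> c"
    if c: "c \<in> carrier (Sub C Z)" for c
  proof -
    have pc: "preimg C g c \<in> carrier (Sub C Y)" using g c by (rule preimg_closed)
    obtain m n p where m: "m \<in> a" and n: "n \<in> c" and p: "p \<in> preimg C g c"
      using Sub_nonempty[OF a] Sub_nonempty[OF c] Sub_nonempty[OF pc] by blast
    have hm: "m \<in> Hom C (Dom C m) X" by (rule Sub_mem[OF a m])
    have "img C g (img C f a) \<sqsubseteq>\<^bsub>Sub C Z\<^esub> c \<longleftrightarrow> factors_through C (f \<cdot> m) p"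
      using img_preimg_adj[OF g fa c] img_le_iff[OF f a m pc p] by simp
    also have "\<dots> \<longleftrightarrow> factors_through C (g \<cdot> (f \<cdot> m)) n"
      by (rule factors_through_preimg_iff[OF g c Comp_Hom[OF hm f] p n])
    also have "\<dots> \<longleftrightarrow> img C (g \<cdot> f) a \<sqsubseteq>\<^bsub>Sub C Z\<^esub> c"
      using img_le_iff[OF gf a m c n] Comp_assoc[OF hm f g] by simp
    finally show ?thesis by simp
  qed
  show ?thesis
    using * img_closed[OF gf a] img_closed[OF g fa] by (meson Z.le_antisym Z.le_refl)
qed

text \<open>Infima suffice, and the class of an intersection is an infimum.\<close>

lemma Sub_complete_lattice:
  assumes X: "X \<in> Ob C"
  shows "complete_lattice (Sub C X)"
proof -
  interpret partial_order "Sub C X" by (rule Sub_partial_order)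
  have inf: "\<exists>i. greatest (Sub C X) i (Lower (Sub C X) A)" if A: "A \<subseteq> carrier (Sub C X)" for A
  proof -
    \<comment> \<open>All representatives of all members of \<open>A\<close> are intersected at
      once, so none has to be chosen.\<close>
    have U: "\<Union>A \<subseteq> {m \<in> MM C. Cod C m = X}"
      using A Sub_mem by blast
    then obtain p where p: "is_intersection C X (\<Union>A) p"
      using intersection_exists[OF X] by blast
    then have pM: "p \<in> MM C" "Cod C p = X"
      using intersection_MM[OF X U] by (auto simp: is_intersection_def Hom_def)
    define i where "i = sub_iso C X `` {p}"
    note i = Sub_class[OF pM, folded i_def]
    have "greatest (Sub C X) i (Lower (Sub C X) A)"
    proof (rule greatest_LowerI[OF _ _ A i(1)])
      fix a assume a: "a \<in> A"
      then have ac: "a \<in> carrier (Sub C X)" using A by blast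
      obtain m where "m \<in> a" using Sub_nonempty[OF ac] by blast
      then show "i \<sqsubseteq>\<^bsub>Sub C X\<^esub> a"
        using Sub_le_iff[OF i ac] p a by (auto simp: is_intersection_def)
    next
      fix b assume b: "b \<in> Lower (Sub C X) A"
      then have bc: "b \<in> carrier (Sub C X)" by (auto simp: Lower_def)
      obtain u where u: "u \<in> b" using Sub_nonempty[OF bc] by blast
      have "factors_through C u m" if "a \<in> A" "m \<in> a" for a m
      proof -
        have "b \<sqsubseteq>\<^bsub>Sub C X\<^esub> a" "a \<in> carrier (Sub C X)"
          using b that(1) A by (auto simp: Lower_def)
        then show ?thesis
          using Sub_le_iff[OF bc u _ that(2)] by simp
      qed
      then have "\<forall>n \<in> \<Union>A. factors_through C u n" by blast
      then have "\<exists>!k. k \<in> Hom C (Dom C u) (Dom C p) \<and> p \<cdot> k = u"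
        using p Sub_mem(3)[OF bc u] unfolding is_intersection_def by simp
      then have "factors_through C u p"
        unfolding factors_through_def by blast
      then show "b \<sqsubseteq>\<^bsub>Sub C X\<^esub> i"
        using Sub_le_iff[OF bc u i] by simp
    qed
    then show ?thesis ..
  qed
  show ?thesis
    \<comment> \<open>The criterion asks for a top element as well; it is the infimum of the empty
      family.\<close>
    using inf[of "{}"] inf by (intro complete_lattice_criterion1) (auto simp: Lower_def)
qed

lemma Sub_eqI:
  assumes "a \<in> carrier (Sub C X)" "b \<in> carrier (Sub C X)"
    and "\<And>c. c \<in> carrier (Sub C X) \<Longrightarrow> c \<sqsubseteq>\<^bsub>Sub C X\<^esub> a \<longleftrightarrow> c \<sqsubseteq>\<^bsub>Sub C X\<^esub> b"
  shows "a = b"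
proof -
  interpret partial_order "Sub C X" by (rule Sub_partial_order)
  show ?thesis
    using assms(3)[OF assms(1)] assms(3)[OF assms(2)] le_refl assms(1,2) by (intro le_antisym) simp_all
qed

lemma Sub_trans:
  assumes "a \<sqsubseteq>\<^bsub>Sub C X\<^esub> b" "b \<sqsubseteq>\<^bsub>Sub C X\<^esub> c"
    and "a \<in> carrier (Sub C X)" "b \<in> carrier (Sub C X)" "c \<in> carrier (Sub C X)"
  shows "a \<sqsubseteq>\<^bsub>Sub C X\<^esub> c"
proof -
  interpret partial_order "Sub C X" by (rule Sub_partial_order)
  show ?thesis using assms by (rule le_trans)
qed

lemma Sub_refl:
  assumes "a \<in> carrier (Sub C X)"
  shows "a \<sqsubseteq>\<^bsub>Sub C X\<^esub> a"
proof -
  interpret partial_order "Sub C X" by (rule Sub_partial_order)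
  show ?thesis using assms by (rule le_refl)
qed

lemma
  assumes X: "X \<in> Ob C" and a: "a \<in> carrier (Sub C X)" and b: "b \<in> carrier (Sub C X)"
  shows Sub_meet_closed: "a \<sqinter>\<^bsub>Sub C X\<^esub> b \<in> carrier (Sub C X)"
    and Sub_le_meet_iff: "c \<in> carrier (Sub C X) \<Longrightarrow>
      c \<sqsubseteq>\<^bsub>Sub C X\<^esub> a \<sqinter>\<^bsub>Sub C X\<^esub> b \<longleftrightarrow> c \<sqsubseteq>\<^bsub>Sub C X\<^esub> a \<and> c \<sqsubseteq>\<^bsub>Sub C X\<^esub> b"
proof -
  interpret complete_lattice "Sub C X" using X by (rule Sub_complete_lattice)
  show m: "a \<sqinter>\<^bsub>Sub C X\<^esub> b \<in> carrier (Sub C X)" using a b by simp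
  show "c \<sqsubseteq>\<^bsub>Sub C X\<^esub> a \<sqinter>\<^bsub>Sub C X\<^esub> b \<longleftrightarrow> c \<sqsubseteq>\<^bsub>Sub C X\<^esub> a \<and> c \<sqsubseteq>\<^bsub>Sub C X\<^esub> b"
    if c: "c \<in> carrier (Sub C X)"
    using le_trans[OF _ meet_left[OF a b] c m a] le_trans[OF _ meet_right[OF a b] c m b]
      meet_le[OF _ _ a b c] by blast
qed

text \<open>By the adjunction it suffices that \<open>a <= b <= f^-1(f(b))\<close>.\<close>

lemma img_mono:
  assumes f: "f \<in> Hom C X Y" and a: "a \<in> carrier (Sub C X)" and b: "b \<in> carrier (Sub C X)"
    and "a \<sqsubseteq>\<^bsub>Sub C X\<^esub> b"
  shows "img C f a \<sqsubseteq>\<^bsub>Sub C Y\<^esub> img C f b"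
proof -
  have fb: "img C f b \<in> carrier (Sub C Y)" using f b by (rule img_closed)
  have "b \<sqsubseteq>\<^bsub>Sub C X\<^esub> preimg C f (img C f b)"
    using img_preimg_adj[OF f b fb] Sub_refl[OF fb] by simp
  then show ?thesis
    using img_preimg_adj[OF f a fb] Sub_trans[OF assms(4) _ a b preimg_closed[OF f fb]] by simp
qed

section \<open>Monotone self-maps, and the quasi-uniformity generated by a base\<close>

lemma endomaps_iff:
  "U \<in> endomaps C X \<longleftrightarrow> U \<in> carrier (Sub C X) \<rightarrow>\<^sub>E carrier (Sub C X) \<and>
     (\<forall>a \<in> carrier (Sub C X). \<forall>b \<in> carrier (Sub C X).
        a \<sqsubseteq>\<^bsub>Sub C X\<^esub> b \<longrightarrow> U a \<sqsubseteq>\<^bsub>Sub C X\<^esub> U b)"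
proof -
  interpret partial_order "Sub C X" by (rule Sub_partial_order)
  show ?thesis
    \<comment> \<open>\<open>isotone\<close> also contains the order axioms for source and target,
      which are discharged here.\<close>
    using weak_partial_order_axioms by (auto simp: endomaps_def isotone_def)
qed

lemma
  assumes "U \<in> endomaps C X"
  shows endomaps_closed: "a \<in> carrier (Sub C X) \<Longrightarrow> U a \<in> carrier (Sub C X)"
    and endomaps_mono: "\<lbrakk>a \<in> carrier (Sub C X); b \<in> carrier (Sub C X); a \<sqsubseteq>\<^bsub>Sub C X\<^esub> b\<rbrakk> \<Longrightarrow>
      U a \<sqsubseteq>\<^bsub>Sub C X\<^esub> U b"
  using assms by (auto simp: endomaps_iff PiE_def)

lemma compose_endomaps:
  assumes U: "U \<in> endomaps C X" and V: "V \<in> endomaps C X"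
  shows "compose (carrier (Sub C X)) U V \<in> endomaps C X"
  unfolding endomaps_iff
proof (intro conjI ballI impI PiE_I)
  fix a b assume "a \<in> carrier (Sub C X)" "b \<in> carrier (Sub C X)" "a \<sqsubseteq>\<^bsub>Sub C X\<^esub> b"
  then show "compose (carrier (Sub C X)) U V a \<sqsubseteq>\<^bsub>Sub C X\<^esub> compose (carrier (Sub C X)) U V b"
    by (simp add: compose_eq endomaps_closed[OF V] endomaps_mono[OF U] endomaps_mono[OF V])
qed (auto simp: compose_def endomaps_closed[OF U] endomaps_closed[OF V])

lemma submap_meet_endomaps:
  assumes X: "X \<in> Ob C" and U: "U \<in> endomaps C X" and V: "V \<in> endomaps C X"
  shows "submap_meet C X U V \<in> endomaps C X"
proof -
  have "U a \<sqinter>\<^bsub>Sub C X\<^esub> V a \<sqsubseteq>\<^bsub>Sub C X\<^esub> U b \<sqinter>\<^bsub>Sub C X\<^esub> V b"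
    if a: "a \<in> carrier (Sub C X)" and b: "b \<in> carrier (Sub C X)" and ab: "a \<sqsubseteq>\<^bsub>Sub C X\<^esub> b" for a b
  proof -
    note cl = endomaps_closed[OF U a] endomaps_closed[OF V a]
      endomaps_closed[OF U b] endomaps_closed[OF V b]
    have m: "U a \<sqinter>\<^bsub>Sub C X\<^esub> V a \<in> carrier (Sub C X)"
      using X cl(1,2) by (rule Sub_meet_closed)
    have "U a \<sqinter>\<^bsub>Sub C X\<^esub> V a \<sqsubseteq>\<^bsub>Sub C X\<^esub> U a" "U a \<sqinter>\<^bsub>Sub C X\<^esub> V a \<sqsubseteq>\<^bsub>Sub C X\<^esub> V a"
      using Sub_le_meet_iff[OF X cl(1,2) m] Sub_refl[OF m] by auto
    then show ?thesis
      using Sub_le_meet_iff[OF X cl(3,4) m] Sub_trans[OF _ endomaps_mono[OF U a b ab] m cl(1,3)]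
        Sub_trans[OF _ endomaps_mono[OF V a b ab] m cl(2,4)] by simp
  qed
  then show ?thesis
    using Sub_meet_closed[OF X endomaps_closed[OF U] endomaps_closed[OF V]]
    by (auto simp: endomaps_iff submap_meet_def)
qed

lemma
  assumes "qu_base C B" and "X \<in> Ob C"
  shows qu_base_endomaps: "U \<in> B X \<Longrightarrow> U \<in> endomaps C X"
    and qu_base_le: "\<lbrakk>U \<in> B X; a \<in> carrier (Sub C X)\<rbrakk> \<Longrightarrow> a \<sqsubseteq>\<^bsub>Sub C X\<^esub> U a"
    and qu_base_compose: "U \<in> B X \<Longrightarrow>
      \<exists>U' \<in> B X. submap_le C X (compose (carrier (Sub C X)) U' U') U"
    and qu_base_meet: "\<lbrakk>U \<in> B X; U' \<in> B X\<rbrakk> \<Longrightarrow> submap_meet C X U U' \<in> B X"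
    and qu_base_img: "\<lbrakk>Y \<in> Ob C; f \<in> Hom C X Y; V \<in> B Y\<rbrakk> \<Longrightarrow>
      \<exists>U \<in> B X. \<forall>a \<in> carrier (Sub C X). img C f (U a) \<sqsubseteq>\<^bsub>Sub C Y\<^esub> V (img C f a)"
  using assms by (auto simp: qu_base_def)

lemma qu_base_generated:
  assumes "qu_base C B" and "X \<in> Ob C" and "U \<in> B X"
  shows "U \<in> qu_generated C B X"
proof -
  have "U \<in> endomaps C X" using assms by (rule qu_base_endomaps)
  then have "U \<in> endomaps C X" "submap_le C X U U"
    using Sub_refl endomaps_closed by (auto simp: submap_le_def)
  then show ?thesis using assms(3) by (auto simp: qu_generated_def)
qed

text \<open>Every axiom for a map \<open>V\<close> is inherited from a base member below it. The
  witnesses for (U2) and (U5) can be taken in the base itself; for (U4) the meet of the two base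
  members lies below the meet of the given maps.\<close>

lemma qu_generated_quasi_uniformity:
  assumes B: "qu_base C B"
  shows "quasi_uniformity C (qu_generated C B)"
proof -
  note sub = qu_base_endomaps[OF B] and u1 = qu_base_le[OF B] and u2 = qu_base_compose[OF B]
    and u4 = qu_base_meet[OF B] and u5 = qu_base_img[OF B]
  have le_trans: "submap_le C X U W"
    if "U \<in> endomaps C X" "V \<in> endomaps C X" "W \<in> endomaps C X"
      "submap_le C X U V" "submap_le C X V W" for X U V W
    using that Sub_trans endomaps_closed unfolding submap_le_def by meson
  note base_gen = qu_base_generated[OF B]
  show ?thesis
    unfolding quasi_uniformity_def qu_base_def
  proof (intro conjI ballI impI)
    fix X assume X: "X \<in> Ob C"
    show "qu_generated C B X \<subseteq> endomaps C X"
      by (auto simp: qu_generated_def)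
    fix V assume "V \<in> qu_generated C B X"
    then obtain U where V: "V \<in> endomaps C X" and U: "U \<in> B X" "submap_le C X U V"
      by (auto simp: qu_generated_def)
    have Ue: "U \<in> endomaps C X" using sub X U by blast
    show "a \<sqsubseteq>\<^bsub>Sub C X\<^esub> V a" if a: "a \<in> carrier (Sub C X)" for a
      using Sub_trans[OF u1[OF X U(1) a] _ a endomaps_closed[OF Ue a] endomaps_closed[OF V a]]
        U(2) a by (simp add: submap_le_def)
    obtain U' where U': "U' \<in> B X" "submap_le C X (compose (carrier (Sub C X)) U' U') U"
      using u2[OF X U(1)] by blast
    have "submap_le C X (compose (carrier (Sub C X)) U' U') V"
      using le_trans[OF compose_endomaps Ue V U'(2) U(2)] sub X U'(1) by blast
    then show "\<exists>V' \<in> qu_generated C B X. submap_le C X (compose (carrier (Sub C X)) V' V') V"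
      using base_gen[OF X U'(1)] by blast
    show "W \<in> qu_generated C B X" if "W \<in> endomaps C X" "submap_le C X V W" for W
      using le_trans[OF Ue V that(1) U(2) that(2)] that(1) U(1) by (auto simp: qu_generated_def)
    fix V' assume "V' \<in> qu_generated C B X"
    then obtain U' where V': "V' \<in> endomaps C X" and U': "U' \<in> B X" "submap_le C X U' V'"
      by (auto simp: qu_generated_def)
    have U'e: "U' \<in> endomaps C X" using sub X U' by blast
    have "submap_le C X (submap_meet C X U U') (submap_meet C X V V')"
      unfolding submap_le_def
    proof
      fix a assume a: "a \<in> carrier (Sub C X)"
      note cl = endomaps_closed[OF Ue a] endomaps_closed[OF U'e a]
        endomaps_closed[OF V a] endomaps_closed[OF V' a]
      have m: "U a \<sqinter>\<^bsub>Sub C X\<^esub> U' a \<in> carrier (Sub C X)"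
        using X cl(1,2) by (rule Sub_meet_closed)
      have "U a \<sqinter>\<^bsub>Sub C X\<^esub> U' a \<sqsubseteq>\<^bsub>Sub C X\<^esub> U a" "U a \<sqinter>\<^bsub>Sub C X\<^esub> U' a \<sqsubseteq>\<^bsub>Sub C X\<^esub> U' a"
        using Sub_le_meet_iff[OF X cl(1,2) m] Sub_refl[OF m] by auto
      then show "submap_meet C X U U' a \<sqsubseteq>\<^bsub>Sub C X\<^esub> submap_meet C X V V' a"
        using Sub_le_meet_iff[OF X cl(3,4) m] Sub_trans[OF _ _ m cl(1,3)]
          Sub_trans[OF _ _ m cl(2,4)] U(2) U'(2) a by (simp add: submap_meet_def submap_le_def)
    qed
    then show "submap_meet C X V V' \<in> qu_generated C B X"
      using submap_meet_endomaps[OF X V V'] u4[OF X U(1) U'(1)] by (auto simp: qu_generated_def)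
  next
    fix X Y f V
    assume X: "X \<in> Ob C" and Y: "Y \<in> Ob C" and f: "f \<in> Hom C X Y" and "V \<in> qu_generated C B Y"
    then obtain U where V: "V \<in> endomaps C Y" and U: "U \<in> B Y" "submap_le C Y U V"
      by (auto simp: qu_generated_def)
    obtain U' where U': "U' \<in> B X"
      "\<And>a. a \<in> carrier (Sub C X) \<Longrightarrow> img C f (U' a) \<sqsubseteq>\<^bsub>Sub C Y\<^esub> U (img C f a)"
      using u5[OF X Y f U(1)] by blast
    have Ue: "U \<in> endomaps C Y" "U' \<in> endomaps C X" using sub X Y U U' by auto
    have "img C f (U' a) \<sqsubseteq>\<^bsub>Sub C Y\<^esub> V (img C f a)" if a: "a \<in> carrier (Sub C X)" for a
    proof -
      have fa: "img C f a \<in> carrier (Sub C Y)" using f a by (rule img_closed)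
      show ?thesis
        using Sub_trans[OF U'(2)[OF a] _ img_closed[OF f endomaps_closed[OF Ue(2) a]]
            endomaps_closed[OF Ue(1) fa] endomaps_closed[OF V fa]] U(2) fa
        by (simp add: submap_le_def)
    qed
    then show "\<exists>V' \<in> qu_generated C B X. \<forall>a \<in> carrier (Sub C X).
        img C f (V' a) \<sqsubseteq>\<^bsub>Sub C Y\<^esub> V (img C f a)"
      using base_gen[OF X U'(1)] by blast
  qed
qed

end

section \<open>Pulling a self-map of subobjects back along an arbitrary morphism\<close>

definition pull_map ::
  "('o, 'a, 'b) fact_cat_scheme \<Rightarrow> 'o \<Rightarrow> 'a \<Rightarrow> ('a set \<Rightarrow> 'a set) \<Rightarrow> 'a set \<Rightarrow> 'a set"
  where
  "pull_map C X f U = (\<lambda>m \<in> carrier (Sub C X). preimg C f (U (img C f m)))"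

context M_complete_category
begin

context
  fixes f X Y
  assumes f: "f \<in> Hom C X Y"
begin

lemma pull_map_apply:
  "a \<in> carrier (Sub C X) \<Longrightarrow> pull_map C X f U a = preimg C f (U (img C f a))"
  by (simp add: pull_map_def)

lemma pull_map_closed:
  assumes "U \<in> endomaps C Y" and "a \<in> carrier (Sub C X)"
  shows "pull_map C X f U a \<in> carrier (Sub C X)"
  using assms preimg_closed[OF f] endomaps_closed img_closed[OF f] by (simp add: pull_map_apply)

text \<open>With \<open>c\<close> arbitrary, this characterizes the pulled back map as the largest
  \<open>V\<close> with \<open>f(V(a)) <= U(f(a))\<close>. Inequalities into a pulled back map are
  thereby checked in the subobjects of \<open>Y\<close>.\<close>

lemma le_pull_map_iff:
  assumes U: "U \<in> endomaps C Y" and a: "a \<in> carrier (Sub C X)" and c: "c \<in> carrier (Sub C X)"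
  shows "c \<sqsubseteq>\<^bsub>Sub C X\<^esub> pull_map C X f U a \<longleftrightarrow> img C f c \<sqsubseteq>\<^bsub>Sub C Y\<^esub> U (img C f a)"
  using img_preimg_adj[OF f c] endomaps_closed[OF U] img_closed[OF f] a by (simp add: pull_map_apply)

lemma img_pull_map_le:
  assumes U: "U \<in> endomaps C Y" and a: "a \<in> carrier (Sub C X)"
  shows "img C f (pull_map C X f U a) \<sqsubseteq>\<^bsub>Sub C Y\<^esub> U (img C f a)"
  using le_pull_map_iff[OF U a] pull_map_closed[OF U a] Sub_refl by blast

text \<open>Monotonicity is \<open>f(V(a)) <= U(f(a)) <= U(f(b))\<close> transported back by the
  adjunction, where \<open>V\<close> is the pulled back map.\<close>

lemma pull_map_endomaps:
  assumes U: "U \<in> endomaps C Y"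
  shows "pull_map C X f U \<in> endomaps C X"
proof -
  have "pull_map C X f U a \<sqsubseteq>\<^bsub>Sub C X\<^esub> pull_map C X f U b"
    if a: "a \<in> carrier (Sub C X)" and b: "b \<in> carrier (Sub C X)" and ab: "a \<sqsubseteq>\<^bsub>Sub C X\<^esub> b" for a b
  proof -
    note fa = img_closed[OF f a] and fb = img_closed[OF f b]
    have "img C f (pull_map C X f U a) \<sqsubseteq>\<^bsub>Sub C Y\<^esub> U (img C f b)"
      using img_pull_map_le[OF U a] endomaps_mono[OF U fa fb img_mono[OF f a b ab]]
      by (rule Sub_trans)
        (auto intro: img_closed[OF f] endomaps_closed[OF U] pull_map_closed[OF U] a b)
    then show ?thesis
      using le_pull_map_iff[OF U b pull_map_closed[OF U a]] by simp
  qed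
  moreover have "pull_map C X f U \<in> extensional (carrier (Sub C X))"
    by (simp add: pull_map_def)
  ultimately show ?thesis
    using pull_map_closed[OF U] by (auto simp: endomaps_iff PiE_def)
qed

lemma pull_map_submap_le:
  assumes U: "U \<in> endomaps C Y" and V: "V \<in> endomaps C Y" and UV: "submap_le C Y U V"
  shows "submap_le C X (pull_map C X f U) (pull_map C X f V)"
  unfolding submap_le_def
proof
  fix a assume a: "a \<in> carrier (Sub C X)"
  have "img C f (pull_map C X f U a) \<sqsubseteq>\<^bsub>Sub C Y\<^esub> V (img C f a)"
    using img_pull_map_le[OF U a] UV[unfolded submap_le_def, rule_format, OF img_closed[OF f a]]
    by (rule Sub_trans)
      (auto intro: img_closed[OF f] endomaps_closed[OF U] endomaps_closed[OF V]
        pull_map_closed[OF U] a)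
  then show "pull_map C X f U a \<sqsubseteq>\<^bsub>Sub C X\<^esub> pull_map C X f V a"
    using le_pull_map_iff[OF V a pull_map_closed[OF U a]] by simp
qed

text \<open>Between the two copies of \<open>U\<close> stands \<open>f\<close> after
  \<open>f^-1\<close>, which lies below the identity:
  \<open>f(V(V(a))) <= U(f(V(a))) <= U(U(f(a)))\<close>. This gives (U2) and half of
  idempotence.\<close>

lemma pull_map_compose_le:
  assumes U: "U \<in> endomaps C Y"
  shows "submap_le C X (compose (carrier (Sub C X)) (pull_map C X f U) (pull_map C X f U))
    (pull_map C X f (compose (carrier (Sub C Y)) U U))"
  unfolding submap_le_def
proof
  fix a assume a: "a \<in> carrier (Sub C X)"
  let ?V = "pull_map C X f U"
  note Va = pull_map_closed[OF U a]
  note cl = img_closed[OF f a] img_closed[OF f Va] img_closed[OF f pull_map_closed[OF U Va]]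
  have "img C f (?V (?V a)) \<sqsubseteq>\<^bsub>Sub C Y\<^esub> U (U (img C f a))"
    using img_pull_map_le[OF U Va]
      endomaps_mono[OF U cl(2) endomaps_closed[OF U cl(1)] img_pull_map_le[OF U a]]
    by (rule Sub_trans) (auto intro: cl endomaps_closed[OF U])
  then show "compose (carrier (Sub C X)) ?V ?V a
      \<sqsubseteq>\<^bsub>Sub C X\<^esub> pull_map C X f (compose (carrier (Sub C Y)) U U) a"
    using img_preimg_adj[OF f pull_map_closed[OF U Va]] endomaps_closed[OF U] cl(1) a
    by (simp add: compose_eq pull_map_apply[of a])
qed

text \<open>A right adjoint preserves meets: the lower bounds \<open>c\<close> of either side are
  those with \<open>f(c)\<close> below both \<open>U(f(a))\<close> and \<open>V(f(a))\<close>. An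
  equality of functions is proved, also off the carrier, because \<open>qu_base\<close> demands
  literal closure under meets.\<close>

lemma pull_map_submap_meet:
  assumes U: "U \<in> endomaps C Y" and V: "V \<in> endomaps C Y"
  shows "submap_meet C X (pull_map C X f U) (pull_map C X f V) = pull_map C X f (submap_meet C Y U V)"
proof
  fix a
  have X: "X \<in> Ob C" and Y: "Y \<in> Ob C" using HomD[OF f] by auto
  have W: "submap_meet C Y U V \<in> endomaps C Y" using Y U V by (rule submap_meet_endomaps)
  show "submap_meet C X (pull_map C X f U) (pull_map C X f V) a = pull_map C X f (submap_meet C Y U V) a"
  proof (cases "a \<in> carrier (Sub C X)")
    case a: True
    note fa = img_closed[OF f a]
    note cl = pull_map_closed[OF U a] pull_map_closed[OF V a]
    have "pull_map C X f U a \<sqinter>\<^bsub>Sub C X\<^esub> pull_map C X f V a = pull_map C X f (submap_meet C Y U V) a"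
    proof (rule Sub_eqI[OF Sub_meet_closed[OF X cl] pull_map_closed[OF W a]])
      fix c assume c: "c \<in> carrier (Sub C X)"
      show "c \<sqsubseteq>\<^bsub>Sub C X\<^esub> pull_map C X f U a \<sqinter>\<^bsub>Sub C X\<^esub> pull_map C X f V a \<longleftrightarrow>
          c \<sqsubseteq>\<^bsub>Sub C X\<^esub> pull_map C X f (submap_meet C Y U V) a"
        using Sub_le_meet_iff[OF X cl c] le_pull_map_iff[OF U a c] le_pull_map_iff[OF V a c]
          le_pull_map_iff[OF W a c] fa
          Sub_le_meet_iff[OF Y endomaps_closed[OF U fa] endomaps_closed[OF V fa] img_closed[OF f c]]
        by (simp add: submap_meet_def)
    qed
    then show ?thesis using a by (simp add: submap_meet_def)
  qed (simp add: submap_meet_def pull_map_def)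
qed

lemma le_pull_map:
  assumes U: "U \<in> endomaps C Y" and "\<And>b. b \<in> carrier (Sub C Y) \<Longrightarrow> b \<sqsubseteq>\<^bsub>Sub C Y\<^esub> U b"
    and a: "a \<in> carrier (Sub C X)"
  shows "a \<sqsubseteq>\<^bsub>Sub C X\<^esub> pull_map C X f U a"
  using assms le_pull_map_iff[OF U a a] img_closed[OF f a] by simp

text \<open>One inequality is \<open>pull_map_compose_le\<close> with \<open>U\<close> idempotent;
  the other holds because the pulled back map is again extensive.\<close>

lemma pull_map_idem:
  assumes U: "U \<in> endomaps C Y" and ext: "\<And>b. b \<in> carrier (Sub C Y) \<Longrightarrow> b \<sqsubseteq>\<^bsub>Sub C Y\<^esub> U b"
    and idem: "compose (carrier (Sub C Y)) U U = U"
  shows "compose (carrier (Sub C X)) (pull_map C X f U) (pull_map C X f U) = pull_map C X f U"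
proof
  interpret partial_order "Sub C X" by (rule Sub_partial_order)
  fix a
  show "compose (carrier (Sub C X)) (pull_map C X f U) (pull_map C X f U) a = pull_map C X f U a"
  proof (cases "a \<in> carrier (Sub C X)")
    case a: True
    note Va = pull_map_closed[OF U a]
    have "pull_map C X f U (pull_map C X f U a) = pull_map C X f U a"
    proof (rule le_antisym)
      show "pull_map C X f U (pull_map C X f U a) \<sqsubseteq>\<^bsub>Sub C X\<^esub> pull_map C X f U a"
        using pull_map_compose_le[OF U] a by (simp add: idem submap_le_def compose_eq)
      show "pull_map C X f U a \<sqsubseteq>\<^bsub>Sub C X\<^esub> pull_map C X f U (pull_map C X f U a)"
        using U ext Va by (rule le_pull_map)
    qed (use Va pull_map_closed[OF U] in auto)
    then show ?thesis using a by (simp add: compose_eq)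
  qed (simp add: compose_def pull_map_def)
qed

end

text \<open>Interpolating \<open>(a, n)\<close> by some \<open>p\<close> gives
  \<open>?u <= p\<close> and \<open>(p, n) \<in> R\<close>, hence \<open>(?u, n) \<in> R\<close> by
  (T2). So everything above \<open>a\<close> in \<open>R\<close> is also above \<open>?u\<close> in
  \<open>R\<close>, while (T1) bounds the next application from below.\<close>

lemma rel_map_idem:
  assumes X: "X \<in> Ob C" and R: "topogenous_rel C X R" and "meet_preserving C X R"
    and "interpolates R"
  shows "compose (carrier (Sub C X)) (rel_map C X R) (rel_map C X R) = rel_map C X R"
proof
  interpret complete_lattice "Sub C X" using X by (rule Sub_complete_lattice)
  fix a
  show "compose (carrier (Sub C X)) (rel_map C X R) (rel_map C X R) a = rel_map C X R a"
  proof (cases "a \<in> carrier (Sub C X)")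
    case a: True
    have RC: "{n. (m, n) \<in> R} \<subseteq> carrier (Sub C X)" for m
      using R by (auto simp: topogenous_rel_def)
    have app: "rel_map C X R m = \<Sqinter>\<^bsub>Sub C X\<^esub> {n. (m, n) \<in> R}"
      "rel_map C X R m \<in> carrier (Sub C X)" if "m \<in> carrier (Sub C X)" for m
      using that inf_closed[OF RC] by (auto simp: rel_map_def)
    let ?u = "rel_map C X R a"
    have u: "?u \<in> carrier (Sub C X)" using a by (rule app)
    have "rel_map C X R ?u = ?u"
    proof (rule le_antisym)
      have "(?u, n) \<in> R" if an: "(a, n) \<in> R" for n
      proof -
        obtain p where p: "(a, p) \<in> R" "(p, n) \<in> R"
          using \<open>interpolates R\<close> an unfolding interpolates_def by blast
        have "?u \<sqsubseteq>\<^bsub>Sub C X\<^esub> p"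
          using inf_lower[OF RC] p(1) app(1)[OF a] by simp
        moreover have "n \<in> carrier (Sub C X)" using RC p(2) by blast
        ultimately show ?thesis
          using R u p(2) le_refl unfolding topogenous_rel_def by blast
      qed
      \<comment> \<open>The meet on the left runs over a larger set than the one defining
        \<open>?u\<close>.\<close>
      then show "rel_map C X R ?u \<sqsubseteq>\<^bsub>Sub C X\<^esub> ?u"
        using inf_greatest[OF RC, of "rel_map C X R ?u" a] inf_lower[OF RC, of _ ?u]
          app[OF u] app(1)[OF a] by simp
      have "?u \<sqsubseteq>\<^bsub>Sub C X\<^esub> n" if "(?u, n) \<in> R" for n
        using R that unfolding topogenous_rel_def by blast
      then show "?u \<sqsubseteq>\<^bsub>Sub C X\<^esub> rel_map C X R ?u"
        using inf_greatest[OF RC, of ?u ?u] u app(1)[OF u] by simp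
    qed (use app u in auto)
    then show ?thesis using a by (simp add: compose_eq)
  qed (simp add: compose_def rel_map_def)
qed

end

section \<open>Pulling a base back along the unit of a pointed endofunctor\<close>

locale pointed_M_complete_category =
  M_complete_category C + pointed_endofunctor C Fo Fa \<eta>
  for C :: "('o, 'a, 'b) fact_cat_scheme" (structure) and Fo Fa \<eta> +
  fixes B :: "'o \<Rightarrow> ('a set \<Rightarrow> 'a set) set"
  assumes base: "qu_base C B"
begin

text \<open>The base \<open>B\<close> is arbitrary here; the family becomes
  \<open>pointed_syn_base\<close> when \<open>B\<close> is the base of a syntopogenous
  structure.\<close>

abbreviation pulled :: "'o \<Rightarrow> ('a set \<Rightarrow> 'a set) set" where
  "pulled X \<equiv> pull_map C X (\<eta> X) ` B (Fo X)"

lemmas base_endomaps = qu_base_endomaps[OF base]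
  and base_le = qu_base_le[OF base]

text \<open>(U1), (U2) and (U4) concern a single object and transfer along \<open>\<eta> X\<close>.
  Functoriality and naturality enter through (U5).\<close>

lemma pulled_base: "qu_base C pulled"
  unfolding qu_base_def
proof (intro conjI ballI)
  fix X assume X: "X \<in> Ob C"
  note FX = F_Ob[OF X] and h = \<eta>_Hom[OF X]
  show "pulled X \<subseteq> endomaps C X"
    using pull_map_endomaps[OF h] base_endomaps[OF FX] by blast
  fix V assume "V \<in> pulled X"
  then obtain U where U: "U \<in> B (Fo X)" and V: "V = pull_map C X (\<eta> X) U" by blast
  note Ue = base_endomaps[OF FX U]
  show "a \<sqsubseteq>\<^bsub>Sub C X\<^esub> V a" if "a \<in> carrier (Sub C X)" for a
    using le_pull_map[OF h Ue base_le[OF FX U] that] V by simp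
  obtain U' where U': "U' \<in> B (Fo X)"
    "submap_le C (Fo X) (compose (carrier (Sub C (Fo X))) U' U') U"
    using qu_base_compose[OF base FX U] by blast
  note U'e = base_endomaps[OF FX U'(1)]
  have "compose (carrier (Sub C (Fo X))) U' U' \<in> endomaps C (Fo X)"
    using U'e U'e by (rule compose_endomaps)
  then have "submap_le C X (pull_map C X (\<eta> X) (compose (carrier (Sub C (Fo X))) U' U')) V"
    and "pull_map C X (\<eta> X) (compose (carrier (Sub C (Fo X))) U' U') \<in> endomaps C X"
    using pull_map_submap_le[OF h _ Ue U'(2)] V pull_map_endomaps[OF h] by auto
  moreover have "pull_map C X (\<eta> X) U' \<in> endomaps C X" "V \<in> endomaps C X"
    using pull_map_endomaps[OF h] U'e Ue V by auto
  \<comment> \<open>Two inequalities are chained: twice the pulled back \<open>U'\<close> lies below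
    the pulled back square of \<open>U'\<close>, and that lies below \<open>V\<close>.\<close>
  ultimately have "submap_le C X (compose (carrier (Sub C X)) (pull_map C X (\<eta> X) U')
      (pull_map C X (\<eta> X) U')) V"
    using pull_map_compose_le[OF h U'e] unfolding submap_le_def
    by (auto intro: Sub_trans simp: compose_eq endomaps_closed)
  then show "\<exists>V' \<in> pulled X. submap_le C X (compose (carrier (Sub C X)) V' V') V"
    using U'(1) by blast
  fix V' assume "V' \<in> pulled X"
  then obtain U' where U': "U' \<in> B (Fo X)" and V': "V' = pull_map C X (\<eta> X) U'" by blast
  have "submap_meet C (Fo X) U U' \<in> B (Fo X)"
    using base FX U U' by (rule qu_base_meet)
  then show "submap_meet C X V V' \<in> pulled X"
    using pull_map_submap_meet[OF h Ue base_endomaps[OF FX U']] V V' by blast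
next
  fix X Y f V assume X: "X \<in> Ob C" and Y: "Y \<in> Ob C" and f: "f \<in> Hom C X Y" and "V \<in> pulled Y"
  then obtain U where U: "U \<in> B (Fo Y)" and V: "V = pull_map C Y (\<eta> Y) U" by blast
  note FX = F_Ob[OF X] and FY = F_Ob[OF Y] and hX = \<eta>_Hom[OF X] and hY = \<eta>_Hom[OF Y]
    and Ff = F_Hom[OF f]
  \<comment> \<open>(U5) is applied to \<open>Fa f\<close> rather than \<open>f\<close>, since
    \<open>U\<close> acts on the subobjects of \<open>Fo Y\<close>.\<close>
  obtain U' where U': "U' \<in> B (Fo X)" "\<And>b. b \<in> carrier (Sub C (Fo X)) \<Longrightarrow>
      img C (Fa f) (U' b) \<sqsubseteq>\<^bsub>Sub C (Fo Y)\<^esub> U (img C (Fa f) b)"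
    using qu_base_img[OF base FX FY Ff U] by blast
  note Ue = base_endomaps[OF FY U] and U'e = base_endomaps[OF FX U'(1)]
  have nat: "img C (Fa f) (img C (\<eta> X) a) = img C (\<eta> Y) (img C f a)"
    if "a \<in> carrier (Sub C X)" for a
    using img_Comp[OF hX Ff that] img_Comp[OF f hY that] \<eta>_natural[OF f] by simp
  have "img C f (pull_map C X (\<eta> X) U' a) \<sqsubseteq>\<^bsub>Sub C Y\<^esub> V (img C f a)"
    if a: "a \<in> carrier (Sub C X)" for a
  proof -
    let ?w = "pull_map C X (\<eta> X) U' a"
    have w: "?w \<in> carrier (Sub C X)" using hX U'e a by (rule pull_map_closed)
    note ha = img_closed[OF hX a] and hw = img_closed[OF hX w]
    note Uha = endomaps_closed[OF U'e ha]
    have "img C (Fa f) (img C (\<eta> X) ?w) \<sqsubseteq>\<^bsub>Sub C (Fo Y)\<^esub> img C (Fa f) (U' (img C (\<eta> X) a))"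
      using img_mono[OF Ff hw Uha img_pull_map_le[OF hX U'e a]] .
    then have "img C (Fa f) (img C (\<eta> X) ?w) \<sqsubseteq>\<^bsub>Sub C (Fo Y)\<^esub> U (img C (Fa f) (img C (\<eta> X) a))"
      using U'(2)[OF ha]
      by (rule Sub_trans) (intro img_closed[OF Ff] endomaps_closed[OF Ue] hw Uha ha)+
    \<comment> \<open>By \<open>nat\<close> the inequality just shown is about images along
      \<open>\<eta> Y\<close> of images along \<open>f\<close>, and the adjunction along
      \<open>\<eta> Y\<close> turns it into the claim.\<close>
    then show ?thesis
      using le_pull_map_iff[OF hY Ue img_closed[OF f a] img_closed[OF f w]] V nat a w by simp
  qed
  then show "\<exists>V' \<in> pulled X. \<forall>a \<in> carrier (Sub C X). img C f (V' a) \<sqsubseteq>\<^bsub>Sub C Y\<^esub> V (img C f a)"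
    using U'(1) by blast
qed

text \<open>The inequality \<open>img_pull_map_le\<close> is continuity of \<open>\<eta> X\<close>.
  Conversely, a witness \<open>V\<close> of continuity for a base member \<open>U\<close> satisfies
  the inequality for which the pulled back \<open>U\<close> is largest, so \<open>V\<close> lies
  below it.\<close>

lemma pulled_coarsest:
  "coarsest_qu C (\<lambda>\<U>. \<forall>X \<in> Ob C. qu_continuous C \<U> (qu_generated C B) (\<eta> X))
     (qu_generated C pulled)"
  unfolding coarsest_qu_def
proof (intro conjI ballI allI impI)
  show "quasi_uniformity C (qu_generated C pulled)"
    using pulled_base by (rule qu_generated_quasi_uniformity)
next
  fix X assume X: "X \<in> Ob C"
  note FX = F_Ob[OF X] and h = \<eta>_Hom[OF X]
  show "qu_continuous C (qu_generated C pulled) (qu_generated C B) (\<eta> X)"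
    unfolding qu_continuous_def HomD(2)[OF h] HomD(3)[OF h]
  proof
    fix W assume "W \<in> qu_generated C B (Fo X)"
    then obtain U where W: "W \<in> endomaps C (Fo X)" and U: "U \<in> B (Fo X)" "submap_le C (Fo X) U W"
      by (auto simp: qu_generated_def)
    note Ue = base_endomaps[OF FX U(1)]
    have pe: "pull_map C X (\<eta> X) U \<in> endomaps C X" using h Ue by (rule pull_map_endomaps)
    then have "pull_map C X (\<eta> X) U \<in> qu_generated C pulled X"
      using qu_base_generated[OF pulled_base X] U(1) by blast
    moreover have "img C (\<eta> X) (pull_map C X (\<eta> X) U a) \<sqsubseteq>\<^bsub>Sub C (Fo X)\<^esub> W (img C (\<eta> X) a)"
      if a: "a \<in> carrier (Sub C X)" for a
      using img_pull_map_le[OF h Ue a] U(2)[unfolded submap_le_def, rule_format, OF img_closed[OF h a]]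
      by (rule Sub_trans)
        (intro img_closed[OF h] endomaps_closed[OF Ue] endomaps_closed[OF W] endomaps_closed[OF pe] a)+
    ultimately show "\<exists>V \<in> qu_generated C pulled X. \<forall>a \<in> carrier (Sub C X).
        img C (\<eta> X) (V a) \<sqsubseteq>\<^bsub>Sub C (Fo X)\<^esub> W (img C (\<eta> X) a)"
      by blast
  qed
next
  fix \<V>
  assume \<V>: "quasi_uniformity C \<V> \<and> (\<forall>X \<in> Ob C. qu_continuous C \<V> (qu_generated C B) (\<eta> X))"
  show "qu_coarser C (qu_generated C pulled) \<V>"
    unfolding qu_coarser_def
  proof (intro ballI)
    fix X W assume X: "X \<in> Ob C" and "W \<in> qu_generated C pulled X"
    then obtain U where W: "W \<in> endomaps C X" and U: "U \<in> B (Fo X)"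
      and UW: "submap_le C X (pull_map C X (\<eta> X) U) W"
      by (auto simp: qu_generated_def)
    note FX = F_Ob[OF X] and h = \<eta>_Hom[OF X]
    note Ue = base_endomaps[OF FX U]
    \<comment> \<open>Continuity refers to the generated quasi-uniformity, so the base member is
      first viewed there.\<close>
    have "U \<in> qu_generated C B (Fo X)"
      using base FX U by (rule qu_base_generated)
    then obtain V where V: "V \<in> \<V> X" "\<And>a. a \<in> carrier (Sub C X) \<Longrightarrow>
        img C (\<eta> X) (V a) \<sqsubseteq>\<^bsub>Sub C (Fo X)\<^esub> U (img C (\<eta> X) a)"
      using \<V> X HomD(2)[OF h] HomD(3)[OF h] unfolding qu_continuous_def by metis
    have Ve: "V \<in> endomaps C X"
      using \<V> X V(1) unfolding quasi_uniformity_def qu_base_def by blast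
    have "V a \<sqsubseteq>\<^bsub>Sub C X\<^esub> W a" if a: "a \<in> carrier (Sub C X)" for a
    proof -
      have "V a \<sqsubseteq>\<^bsub>Sub C X\<^esub> pull_map C X (\<eta> X) U a"
        using le_pull_map_iff[OF h Ue a endomaps_closed[OF Ve a]] V(2)[OF a] by simp
      then show ?thesis
        using UW[unfolded submap_le_def, rule_format, OF a]
        by (rule Sub_trans)
          (intro endomaps_closed[OF Ve] endomaps_closed[OF W] pull_map_closed[OF h Ue] a)+
    qed
    then show "\<exists>V \<in> \<V> X. submap_le C X V W"
      using V(1) by (auto simp: submap_le_def)
  qed
qed

lemma pulled_transitive:
  assumes "\<And>X U. \<lbrakk>X \<in> Ob C; U \<in> B X\<rbrakk> \<Longrightarrow> compose (carrier (Sub C X)) U U = U"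
  shows "transitive_base C pulled"
  using pulled_base pull_map_idem[OF \<eta>_Hom base_endomaps[OF F_Ob] base_le[OF F_Ob] assms[OF F_Ob]]
  by (auto simp: transitive_base_def)

end

theorem proposition5:
  fixes C :: "('o, 'a, 'b) fact_cat_scheme"
    and Fo :: "'o \<Rightarrow> 'o" and Fa :: "'a \<Rightarrow> 'a" and \<eta> :: "'o \<Rightarrow> 'a"
    and S :: "'o \<Rightarrow> 'a set rel set"
  assumes "EE_stable_category C"
    and "pointed_endofunctor C Fo Fa \<eta>"
    and "syntopogenous C S"
    and "co_perfect C S"
    and "qu_base C (syn_base C S)"
  shows "qu_base C (pointed_syn_base C Fo \<eta> S) \<and>
    coarsest_qu C
      (\<lambda>\<U>. \<forall>X \<in> Ob C. qu_continuous C \<U> (qu_generated C (syn_base C S)) (\<eta> X))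
      (qu_generated C (pointed_syn_base C Fo \<eta> S)) \<and>
    (interpolative C S \<longrightarrow> transitive_base C (pointed_syn_base C Fo \<eta> S))"
proof -
  interpret EE_stable_category C by (rule assms)
  interpret pointed_endofunctor C Fo Fa \<eta> by (rule assms)
  interpret pointed_M_complete_category C Fo Fa \<eta> "syn_base C S"
    using assms(5) by unfold_locales
  have eq: "pointed_syn_base C Fo \<eta> S = pulled"
    by (intro ext) (auto simp: pointed_syn_base_def pull_map_def)
  \<comment> \<open>Proved at every object, because transitivity of the pulled back base at
    \<open>X\<close> relies on idempotence at \<open>Fo X\<close>.\<close>
  have "compose (carrier (Sub C X)) U U = U"
    if "interpolative C S" "X \<in> Ob C" "U \<in> syn_base C S X" for X U
    using that assms(3,4) rel_map_idem
    by (auto simp: syn_base_def interpolative_def syntopogenous_def co_perfect_def)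
  then show ?thesis
    unfolding eq using pulled_base pulled_coarsest pulled_transitive by blast
qed

end
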